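(* Let $a_0,\dots,a_5\in\mathbb{C}$ be pairwise distinct and let $X\subset\mathbb{P}^5$ be the Kummer surface which is the (smooth) complete intersection of the three quadrics $$Q_0:\ \sum_{i=0}^5 x_i^2=0,\qquad Q_1:\ \sum_{i=0}^5 a_i x_i^2=0,\qquad Q_2:\ \sum_{i=0}^5 a_i^2x_i^2=0 .$$ Then $X$ is a $\Phi$ surface which is not covered by lines (that is, through a general point of $X$ there passes no line contained in $X$). Moreover, for a general point $x\in X$, the involution $\sigma_x$ on $\mathbb{P}(T_xX)$ whose pairs are cut out on the embedded tangent plane $\mathbb{T}_xX$ by the quadrics of the net $\mathcal{N}=\langle Q_0,Q_1,Q_2\rangle$ not containing $\mathbb{T}_xX$ coincides with the involution $\tau_x$ on $\mathbb{P}(T_xX)$ whose pairs are the members of the pencil $|II_x|$, i.e. the pairs of tangent directions at $x$ of the tangent hyperplane sections of $X$ having $x$ as a double point.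
   Context: Everything is over $\mathbb{C}$. Second fundamental form. Let $X\subset\mathbb{P}^N=\mathbb{P}(V)$ be a projective surface and $x\in X$ a smooth point. Denote by $T_xX$ the tangent space, by $\mathbb{T}_xX\subset\mathbb{P}^N$ the embedded tangent plane, by $\hat{\mathbb{T}}_xX\subset V$ the cone over it, and by $N_xX=V/\hat{\mathbb{T}}_xX$ the normal space. The differential at $x$ of the Gauss map $X\dashrightarrow\mathbb{G}(2,N)$, $x\mapsto\mathbb{T}_xX$, induces a symmetric bilinear map $II_x:T_xX\times T_xX\to N_xX$, equivalently a linear map $\mathrm{Sym}^{(2)}T_xX\to N_xX$, called the projective second fundamental form of $X$ at $x$. Its dual sends a tangent hyperplane $H\supset\mathbb{T}_xX$ to a quadratic form on $T_xX$ (determined up to scalar): the one whose zero locus in $\mathbb{P}(T_xX)\cong\mathbb{P}^1$ is the projectivized tangent cone at $x$ of $H\cap X$ when $x$ is a double point of $H\cap X$, and the zero form when $x$ has multiplicity at least $3$ on $H\cap X$. The image of this dual map defines a linear system $|II_x|$ of quadrics in $\mathbb{P}(T_xX)$. One has $\dim|II_x|=\dim\mathbb{T}^{(2)}_xX-3$, where $\mathbb{T}^{(2)}_xX$ is the embedded second osculating space, i.e. the projective linear space through $x$ spanned by the partial derivatives of order $\le 2$ at $x$ of a local parametrization of $X$. $\Phi$ surface: a surface $X\subset\mathbb{P}^N$ with $N\ge 5$ such that at a general point $x\in X$ one has $\dim|II_x|=1$, i.e. $\dim\mathbb{T}^{(2)}_xX=4$. The involution $\tau_x$: when $|II_x|$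 is a base-point-free pencil of quadrics in $\mathbb{P}(T_xX)\cong\mathbb{P}^1$, its members (zero divisors of degree $2$) are the pairs of an involution $\tau_x$ of $\mathbb{P}(T_xX)$. The involution $\sigma_x$: identify $\mathbb{P}(T_xX)$ with the pencil of lines in $\mathbb{T}_xX$ passing through $x$. For $x$ general in the surface $X$ of the claim, there is exactly one quadric of the net $\mathcal{N}$ containing $\mathbb{T}_xX$; every other quadric of $\mathcal{N}$ meets $\mathbb{T}_xX$ in a pair of lines (possibly coinciding) through $x$, and these pairs of lines are the pairs of an involution $\sigma_x$ of the pencil of lines through $x$ in $\mathbb{T}_xX$. *)

theory Defs
  imports "HOL-Analysis.Analysis" "HOL-Library.Function_Algebras"
begin

text \<open>
  A subset of \<open>\<bbbP>\<^sup>N = \<bbbP>(V)\<close>, \<open>V = \<complex>\<^sup>N\<^sup>+\<^sup>1\<close>, is represented by the set of all homogeneous coordinate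
  vectors of its points, i.e. by a subset of \<open>V - {0}\<close> closed under nonzero scaling; the index type
  \<open>'n\<close> has \<open>N + 1\<close> elements. Linear subspaces of \<open>\<bbbP>\<^sup>N\<close> are represented by linear subspaces of \<open>V\<close>, so
  that a projective line is a two-dimensional linear subspace.
\<close>

definition form :: "nat \<Rightarrow> (complex^'n \<Rightarrow> complex) \<Rightarrow> bool" where
  "form d F \<longleftrightarrow> (\<exists>c. \<forall>x. F x =
     (\<Sum>m | (\<Sum>i\<in>UNIV. m i) = d. c m * (\<Prod>i\<in>UNIV. (x $ i) ^ m i)))"

lemma finite_exponents: "finite {m :: 'n::finite \<Rightarrow> nat. (\<Sum>i\<in>UNIV. m i) = d}"
proof (rule finite_subset)
  show "{m :: 'n \<Rightarrow> nat. (\<Sum>i\<in>UNIV. m i) = d} \<subseteq> (\<Pi>\<^sub>E i\<in>UNIV. {..d})"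
    by (auto simp: PiE_def intro: member_le_sum)
  show "finite (\<Pi>\<^sub>E i\<in>(UNIV :: 'n set). {..d})"
    by (intro finite_PiE) auto
qed

definition zariski_closed :: "(complex^'n) set \<Rightarrow> bool" where
  "zariski_closed Z \<longleftrightarrow>
     (\<exists>S. (\<forall>F\<in>S. \<exists>d. form d F) \<and> Z = {x. x \<noteq> 0 \<and> (\<forall>F\<in>S. F x = 0)})"

definition projective_variety :: "(complex^'n) set \<Rightarrow> bool" where
  "projective_variety X \<longleftrightarrow> zariski_closed X \<and> X \<noteq> {} \<and>
     (\<forall>Y Z. zariski_closed Y \<and> zariski_closed Z \<and> X \<subseteq> Y \<union> Z \<longrightarrow> X \<subseteq> Y \<or> X \<subseteq> Z)"

text \<open>
  A property holds at a general point of a variety if it holds on a nonempty Zariski open subset.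
\<close>

definition general_point :: "(complex^'n) set \<Rightarrow> (complex^'n \<Rightarrow> bool) \<Rightarrow> bool" where
  "general_point X P \<longleftrightarrow>
     (\<exists>Z. zariski_closed Z \<and> \<not> X \<subseteq> Z \<and> (\<forall>x\<in>X - Z. P x))"

text \<open>
  A local holomorphic parametrization of a surface near \<open>p\<close>: a holomorphic lift \<open>\<phi> : U \<rightarrow> V - {0}\<close>,
  \<open>0 \<in> U \<subseteq> \<complex>\<^sup>2\<close>, such that \<open>s \<mapsto> [\<phi> s]\<close> is an immersion into \<open>\<bbbP>(V)\<close> and a homeomorphism onto an
  open neighbourhood of \<open>[p]\<close> in \<open>X\<close>. The derivative of \<open>s \<mapsto> [\<phi> s]\<close> is \<open>D\<close> modulo the line of
  \<open>\<phi> s\<close>. Requiring the map to be open, and not only its image, excludes parametrizations of one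
  branch that return to a point of another branch.
\<close>

definition local_param ::
  "(complex^'n) set \<Rightarrow> complex^'n \<Rightarrow> (complex^2 \<Rightarrow> complex^'n) \<Rightarrow> bool" where
  "local_param X p \<phi> \<longleftrightarrow> (\<exists>U. open U \<and> 0 \<in> U \<and> \<phi> 0 = p \<and> \<phi> ` U \<subseteq> X \<and>
     (\<forall>s\<in>U. \<exists>D. (\<phi> has_derivative D) (at s) \<and> (\<forall>c v. D (c *s v) = c *s D v) \<and>
                 (\<forall>v. D v \<in> vec.span {\<phi> s} \<longrightarrow> v = 0)) \<and>
     (\<forall>s\<in>U. \<forall>t\<in>U. \<forall>c. \<phi> s = c *s \<phi> t \<longrightarrow> s = t) \<and>
     (\<forall>W. open W \<and> W \<subseteq> U \<longrightarrow>
        openin (top_of_set X) {c *s \<phi> s | c s. c \<noteq> 0 \<and> s \<in> W}))"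

text \<open>
  A point is smooth of dimension 2 if \<open>X\<close> is a two-dimensional complex submanifold near it. The
  dimension of a variety is the dimension of the connected complex manifold of its smooth points,
  so it is 2 as soon as there is one such point.
\<close>

definition smooth_point :: "(complex^'n) set \<Rightarrow> complex^'n \<Rightarrow> bool" where
  "smooth_point X p \<longleftrightarrow> p \<in> X \<and> (\<exists>\<phi>. local_param X p \<phi>)"

definition projective_surface :: "(complex^'n) set \<Rightarrow> bool" where
  "projective_surface X \<longleftrightarrow> projective_variety X \<and> (\<exists>p\<in>X. smooth_point X p)"

definition not_covered_by_lines :: "(complex^'n) set \<Rightarrow> bool" where
  "not_covered_by_lines X \<longleftrightarrow>
     general_point X (\<lambda>p. \<not> (\<exists>L. vec.subspace L \<and> vec.dim L = 2 \<and> p \<in> L \<and> L - {0} \<subseteq> X))"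

definition ddir :: "(complex^2 \<Rightarrow> complex^'n) \<Rightarrow> complex^2 \<Rightarrow> complex^2 \<Rightarrow> complex^'n"
  where "ddir f w s = (\<chi> i. deriv (\<lambda>z. f (s + z *s w) $ i) 0)"

text \<open>
  The notions below are defined through a chosen local parametrization \<open>\<phi>\<close> at a smooth point \<open>p\<close>.
  Passing to another one changes coordinates on \<open>T\<^sub>pX = \<complex>\<^sup>2\<close> and rescales, and changes second
  derivatives by elements of the cone over the embedded tangent plane; the embedded tangent plane,
  the linear system \<open>|II\<^sub>p|\<close> up to this identification, its dimension, and the pairs of tangent
  lines cut out by its members do not depend on the choice.
\<close>

definition chart :: "(complex^'n) set \<Rightarrow> complex^'n \<Rightarrow> complex^2 \<Rightarrow> complex^'n" where
  "chart X p = (SOME \<phi>. local_param X p \<phi>)"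

text \<open>
  The Gauss map in the parametrization: \<open>s\<close> is sent to the cone over the embedded tangent plane at
  \<open>[\<phi> s]\<close>.
\<close>

definition gauss :: "(complex^2 \<Rightarrow> complex^'n) \<Rightarrow> complex^2 \<Rightarrow> (complex^'n) set" where
  "gauss \<phi> s = vec.span (insert (\<phi> s) (range (\<lambda>w. ddir \<phi> w s)))"

definition emb_tangent :: "(complex^'n) set \<Rightarrow> complex^'n \<Rightarrow> (complex^'n) set" where
  "emb_tangent X p = gauss (chart X p) 0"

text \<open>
  The differential of the Gauss map in the direction \<open>w'\<close> is the linear map from the cone over the
  tangent plane to \<open>N\<^sub>p = V / emb_tangent X p\<close> that differentiates sections of the moving subspace
  \<open>gauss \<phi> s\<close>. It kills the section \<open>\<phi>\<close> and sends the section \<open>ddir \<phi> w\<close> to \<open>II(w, w')\<close>. The value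
  given here is a representative in \<open>V\<close> of the class in \<open>N\<^sub>p\<close>.
\<close>

definition II :: "(complex^'n) set \<Rightarrow> complex^'n \<Rightarrow> complex^2 \<Rightarrow> complex^2 \<Rightarrow> complex^'n" where
  "II X p w w' = ddir (ddir (chart X p) w) w' 0"

definition pairing :: "complex^'n \<Rightarrow> complex^'n \<Rightarrow> complex" where
  "pairing h v = (\<Sum>i\<in>UNIV. h $ i * v $ i)"

text \<open>
  The dual of \<open>N\<^sub>p\<close>: equations of hyperplanes containing the embedded tangent plane.
\<close>

definition conormal :: "(complex^'n) set \<Rightarrow> complex^'n \<Rightarrow> (complex^'n) set" where
  "conormal X p = {h. \<forall>t\<in>emb_tangent X p. pairing h t = 0}"

text \<open>
  The image of the dual map, as a linear space of quadratic forms on \<open>T\<^sub>pX = \<complex>\<^sup>2\<close>; its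
  projectivization is \<open>|II\<^sub>p|\<close>. The form of \<open>h\<close> is twice the quadratic part at \<open>0\<close> of the local
  equation \<open>pairing h \<circ> \<phi>\<close> of the hyperplane section, which has no terms of order less than 2: its
  zeros are the tangent cone if \<open>p\<close> is a double point, and it is zero if the multiplicity is larger.
\<close>

definition II_forms :: "(complex^'n) set \<Rightarrow> complex^'n \<Rightarrow> (complex^2 \<Rightarrow> complex) set" where
  "II_forms X p = (\<lambda>h w. pairing h (II X p w w)) ` conormal X p"

global_interpretation cfun: vector_space "\<lambda>(c::complex) (f::'a \<Rightarrow> complex) x. c * f x"
  by unfold_locales (auto simp: fun_eq_iff algebra_simps)

definition dim_II :: "(complex^'n) set \<Rightarrow> complex^'n \<Rightarrow> int" where
  "dim_II X p = int (cfun.dim (II_forms X p)) - 1"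

definition II_base_point_free :: "(complex^'n) set \<Rightarrow> complex^'n \<Rightarrow> bool" where
  "II_base_point_free X p \<longleftrightarrow> (\<forall>w. w \<noteq> 0 \<longrightarrow> (\<exists>q\<in>II_forms X p. q w \<noteq> 0))"

definition Phi_surface :: "(complex^'n) set \<Rightarrow> bool" where
  "Phi_surface X \<longleftrightarrow> projective_surface X \<and> CARD('n) \<ge> 6 \<and>
     general_point X (\<lambda>p. smooth_point X p \<and> dim_II X p = 1)"

text \<open>
  \<open>\<bbbP>(T\<^sub>pX)\<close>, identified with the pencil of lines through \<open>p\<close> in the embedded tangent plane. The
  tangent direction of \<open>w\<close> corresponds to the line \<open>tangent_line X p w\<close>.
\<close>

definition tangent_lines :: "(complex^'n) set \<Rightarrow> complex^'n \<Rightarrow> (complex^'n) set set" where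
  "tangent_lines X p =
     {L. vec.subspace L \<and> vec.dim L = 2 \<and> p \<in> L \<and> L \<subseteq> emb_tangent X p}"

definition tangent_line :: "(complex^'n) set \<Rightarrow> complex^'n \<Rightarrow> complex^2 \<Rightarrow> (complex^'n) set" where
  "tangent_line X p w = vec.span {p, ddir (chart X p) w 0}"

text \<open>
  An effective divisor of degree 2 on the projective line is represented by its support, a set
  \<open>{L, L'}\<close>, where \<open>L = L'\<close> stands for the divisor \<open>2L\<close>.
\<close>

definition II_pairs :: "(complex^'n) set \<Rightarrow> complex^'n \<Rightarrow> (complex^'n) set set set" where
  "II_pairs X p =
     {{tangent_line X p w | w. w \<noteq> 0 \<and> q w = 0} | q. q \<in> II_forms X p \<and> q \<noteq> (\<lambda>w. 0)}"

definition contains_tangent_plane ::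
  "(complex^'n \<Rightarrow> complex) \<Rightarrow> (complex^'n) set \<Rightarrow> complex^'n \<Rightarrow> bool" where
  "contains_tangent_plane Q X p \<longleftrightarrow> (\<forall>t\<in>emb_tangent X p. Q t = 0)"

definition lines_cut ::
  "(complex^'n \<Rightarrow> complex) \<Rightarrow> (complex^'n) set \<Rightarrow> complex^'n \<Rightarrow> (complex^'n) set set" where
  "lines_cut Q X p = {L \<in> tangent_lines X p. \<forall>t\<in>L. Q t = 0}"

definition net_pairs ::
  "(complex^'n \<Rightarrow> complex) set \<Rightarrow> (complex^'n) set \<Rightarrow> complex^'n \<Rightarrow> (complex^'n) set set set" where
  "net_pairs \<N> X p = {lines_cut Q X p | Q. Q \<in> \<N> \<and> \<not> contains_tangent_plane Q X p}"

text \<open>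
  An involution of a pencil \<open>P\<close> of lines is a projective automorphism of order 2; automorphisms of
  the pencil are induced by linear maps. Its pairs are the sets \<open>{L, \<tau> L}\<close>.
\<close>

definition involution_with_pairs ::
  "(complex^'n) set set \<Rightarrow> ((complex^'n) set \<Rightarrow> (complex^'n) set) \<Rightarrow> (complex^'n) set set set \<Rightarrow> bool"
  where
  "involution_with_pairs P \<tau> \<D> \<longleftrightarrow>
     (\<exists>f :: complex^'n \<Rightarrow> complex^'n.
        Vector_Spaces.linear (*s) (*s) f \<and> (\<forall>L\<in>P. \<tau> L = f ` L)) \<and>
     (\<forall>L\<in>P. \<tau> L \<in> P \<and> \<tau> (\<tau> L) = L) \<and> (\<exists>L\<in>P. \<tau> L \<noteq> L) \<and>
     \<D> = {{L, \<tau> L} | L. L \<in> P}"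

text \<open>
  The map sending \<open>L\<close> to its partner in the pair containing it; meaningful when every element of the
  pencil lies in exactly one pair.
\<close>

definition partner :: "'b set set \<Rightarrow> 'b \<Rightarrow> 'b" where
  "partner \<D> L = (THE L'. {L, L'} \<in> \<D>)"

definition tau_II :: "(complex^'n) set \<Rightarrow> complex^'n \<Rightarrow> (complex^'n) set \<Rightarrow> (complex^'n) set" where
  "tau_II X p = partner (II_pairs X p)"

definition sigma_net :: "(complex^'n \<Rightarrow> complex) set \<Rightarrow> (complex^'n) set \<Rightarrow> complex^'n \<Rightarrow>
    (complex^'n) set \<Rightarrow> (complex^'n) set" where
  "sigma_net \<N> X p = partner (net_pairs \<N> X p)"

definition quadric :: "(6 \<Rightarrow> complex) \<Rightarrow> nat \<Rightarrow> complex^6 \<Rightarrow> complex" where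
  "quadric a k x = (\<Sum>i\<in>UNIV. a i ^ k * (x $ i)\<^sup>2)"

definition kummer :: "(6 \<Rightarrow> complex) \<Rightarrow> (complex^6) set" where
  "kummer a = {x. x \<noteq> 0 \<and> quadric a 0 x = 0 \<and> quadric a 1 x = 0 \<and> quadric a 2 x = 0}"

definition kummer_net :: "(6 \<Rightarrow> complex) \<Rightarrow> (complex^6 \<Rightarrow> complex) set" where
  "kummer_net a = cfun.span {quadric a 0, quadric a 1, quadric a 2}"

end

theory Submission
  imports Defs "HOL-Complex_Analysis.Conformal_Mappings"
begin

text \<open>
  Put \<open>A(t) = (t - a\<^sub>0) \<dots> (t - a\<^sub>5)\<close> and \<open>w\<^sub>i = 1 / A'(a\<^sub>i)\<close>. By Lagrange interpolation
  \<open>\<Sum> w\<^sub>i f(a\<^sub>i)\<close> is the coefficient of \<open>t\<^sup>5\<close> in \<open>f\<close> whenever \<open>deg f \<le> 5\<close>. Hence the vectors \<open>y\<close> with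
  \<open>\<Sum> a\<^sub>i\<^sup>k y\<^sub>i = 0\<close> for \<open>k = 0, 1, 2\<close> are exactly the vectors \<open>(w\<^sub>i R(a\<^sub>i))\<close> with \<open>R\<close> a polynomial of
  degree at most 2 (\<open>interp_correct\<close>). Applied to \<open>y\<^sub>i = x\<^sub>i\<^sup>2\<close>, this attaches to each point \<open>x\<close> of the
  Kummer surface a quadratic polynomial \<open>P\<close> with \<open>x\<^sub>i\<^sup>2 = w\<^sub>i P(a\<^sub>i)\<close>, which determines \<open>x\<close> up to signs.

  Let \<open>x\<close> have nonzero coordinates and let \<open>P\<close> have degree 2 and distinct roots \<open>e\<^sub>1, e\<^sub>2\<close>; these are
  open conditions given by the nonvanishing of one form. The embedded tangent plane consists of the
  \<open>v\<close> with \<open>x\<^sub>i v\<^sub>i = w\<^sub>i R(a\<^sub>i)\<close>, \<open>deg R \<le> 2\<close>, and \<open>x\<close> itself corresponds to \<open>R = P\<close>. A quadric of the net is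
  \<open>\<Sum> S(a\<^sub>i) x\<^sub>i\<^sup>2\<close> with \<open>deg S \<le> 2\<close>, and its value at \<open>v\<close> is \<open>\<Sum> w\<^sub>i S(a\<^sub>i) R(a\<^sub>i)\<^sup>2 / P(a\<^sub>i)\<close>, a sum of residues
  of \<open>S R\<^sup>2 / (A P)\<close>. There is no residue at infinity, so the sum is minus the residues at the
  roots of \<open>P\<close>: it equals \<open>g\<^sub>1 S(e\<^sub>1) R(e\<^sub>1)\<^sup>2 + g\<^sub>2 S(e\<^sub>2) R(e\<^sub>2)\<^sup>2\<close> with nonzero constants \<open>g\<^sub>1, g\<^sub>2\<close>
  (\<open>net_quadric_on_plane\<close>). So \<open>r\<^sub>j = R(e\<^sub>j)\<close> are homogeneous coordinates on the pencil of tangent lines at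
  \<open>x\<close>, the net restricts to the pencil of diagonal forms \<open>\<alpha> r\<^sub>1\<^sup>2 + \<beta> r\<^sub>2\<^sup>2\<close>, only the multiples of the quadric
  with \<open>S = P\<close> vanish on the plane, and the pairs are those of \<open>(r\<^sub>1 : r\<^sub>2) \<mapsto> (r\<^sub>1 : - r\<^sub>2)\<close>.

  For the second fundamental form, the equations of tangent hyperplanes are \<open>h\<^sub>i = x\<^sub>i S(a\<^sub>i)\<close>.
  Differentiating \<open>\<Sum> S(a\<^sub>i) \<phi>\<^sub>i\<^sup>2 = 0\<close> twice along a parametrization \<open>\<phi>\<close> gives
  \<open>\<Sum> h\<^sub>i \<phi>\<^sub>i'' = - \<Sum> S(a\<^sub>i) (\<phi>\<^sub>i')\<^sup>2\<close>, so \<open>|II|\<close> is the same pencil of diagonal forms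
  (\<open>kummer_chart_exists\<close>, \<open>II_forms_eq\<close>). Both involutions therefore coincide, the pencil has
  dimension 1 and no base point. A line of the surface through \<open>x\<close> would be a tangent line on
  which all these forms vanish, so there is none.

  The surface is smooth because its points are recovered from two of their coordinates by explicit
  square roots (\<open>local_param_exists\<close>). For irreducibility it suffices, by the identity theorem in these
  charts, that the cone over it is connected: squares of coordinates can be moved along segments
  in the kernel of the three moments, and moving to a point with \<open>x\<^sub>j = 0\<close> and back along the reflected
  path changes the sign of \<open>x\<^sub>j\<close> (\<open>connected_kummer\<close>).
\<close>

section \<open>Quadratic polynomials and the kernel of three moments\<close>

locale six_points =
  fixes a :: "6 \<Rightarrow> complex"
  assumes inj_a: "inj a"
begin

definition weight :: "6 \<Rightarrow> complex" where
  "weight i = 1 / (\<Prod>j\<in>UNIV - {i}. a i - a j)"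

text \<open>
  Up to the factor \<open>weight i\<close> this is the Lagrange basis polynomial of the node \<open>a i\<close>.
\<close>

definition node_poly :: "6 \<Rightarrow> complex poly" where
  "node_poly i = (\<Prod>j\<in>UNIV - {i}. [:- a j, 1:])"

lemma weight_nonzero: "weight i \<noteq> 0"
  using inj_a by (auto simp: weight_def inj_eq)

lemma degree_node_poly: "degree (node_poly i) = 5"
  unfolding node_poly_def by (subst degree_prod_eq_sum_degree) auto

lemma lead_node_poly: "coeff (node_poly i) 5 = 1"
proof -
  have "lead_coeff (node_poly i) = 1"
    unfolding node_poly_def by (subst lead_coeff_prod) auto
  then show ?thesis by (simp add: degree_node_poly)
qed

lemma poly_node_poly: "poly (node_poly i) (a k) = (if k = i then 1 / weight i else 0)"
proof (cases "k = i")
  case True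
  then show ?thesis by (simp add: node_poly_def weight_def poly_prod)
next
  case False
  then show ?thesis by (auto simp: node_poly_def poly_prod prod_zero_iff)
qed

text \<open>
  Both sides are the leading coefficient in Lagrange's interpolation formula for \<open>f\<close>. Equivalently,
  the residues of \<open>f / A\<close>, \<open>A\<close> being the monic polynomial with roots \<open>a i\<close>, sum to zero.
\<close>

lemma weight_sum:
  assumes "degree f \<le> 5"
  shows "(\<Sum>i\<in>UNIV. weight i * poly f (a i)) = coeff f 5"
proof -
  define g where "g = (\<Sum>i\<in>UNIV. smult (weight i * poly f (a i)) (node_poly i))"
  have "f = g"
  proof (rule poly_eqI_degree)
    have "degree g \<le> 5"
      unfolding g_def
      by (intro degree_sum_le) (auto intro: order_trans[OF degree_smult_le] simp: degree_node_poly)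
    moreover have "card (range a) = 6"
      using inj_a by (simp add: card_image)
    ultimately show "degree f < card (range a)" "degree g < card (range a)"
      using assms by auto
    fix x assume "x \<in> range a"
    then obtain k where x: "x = a k" by auto
    have "poly g x = (\<Sum>i\<in>UNIV. if i = k then poly f x else 0)"
      unfolding g_def poly_sum x using weight_nonzero
      by (intro sum.cong) (auto simp: poly_node_poly)
    then show "poly f x = poly g x" by simp
  qed
  then have "coeff f 5 = coeff g 5" by simp
  also have "\<dots> = (\<Sum>i\<in>UNIV. weight i * poly f (a i))"
    by (simp add: g_def coeff_sum lead_node_poly)
  finally show ?thesis by simp
qed

definition moment :: "nat \<Rightarrow> (6 \<Rightarrow> complex) \<Rightarrow> complex" where
  "moment k z = (\<Sum>i\<in>UNIV. a i ^ k * z i)"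

lemma moment_add: "moment k (\<lambda>i. y i + z i) = moment k y + moment k z"
  by (simp add: moment_def algebra_simps sum.distrib)

lemma moment_diff: "moment k (\<lambda>i. y i - z i) = moment k y - moment k z"
  by (simp add: moment_def algebra_simps sum_subtractf)

lemma moment_scale: "moment k (\<lambda>i. c * z i) = c * moment k z"
  by (simp add: moment_def sum_distrib_left algebra_simps)

text \<open>
  Invertibility of the Vandermonde matrix.
\<close>

lemma moments_determine:
  assumes "\<And>k. k \<le> 5 \<Longrightarrow> moment k z = 0"
  shows "z i = 0"
proof -
  have "(\<Sum>j\<in>UNIV. poly (node_poly i) (a j) * z j)
      = (\<Sum>k\<le>5. coeff (node_poly i) k * moment k z)"
    unfolding moment_def poly_altdef degree_node_poly sum_distrib_left sum_distrib_right
    by (subst sum.swap) (simp add: mult.assoc)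
  also have "\<dots> = 0"
    using assms by simp
  also have "(\<Sum>j\<in>UNIV. poly (node_poly i) (a j) * z j) = (\<Sum>j\<in>UNIV. if j = i then z i / weight i else 0)"
    by (intro sum.cong) (auto simp: poly_node_poly)
  finally show ?thesis using weight_nonzero[of i] by simp
qed

text \<open>
  If \<open>z i = weight i * poly R (a i)\<close> with \<open>R\<close> of degree at most 2, then the moments of order 3, 4, 5 of \<open>z\<close>
  are triangular in the coefficients of \<open>R\<close>, because the moments of \<open>weight\<close> are 0 up to order 4 and 1
  in order 5. The definition inverts this triangular system. It is linear in \<open>z\<close>, hence
  polynomial in the coordinates when \<open>z\<close> is.
\<close>

definition interp :: "(6 \<Rightarrow> complex) \<Rightarrow> complex poly" where
  "interp z =
     (let c2 = moment 3 z;
          c1 = moment 4 z - moment 6 weight * c2;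
          c0 = moment 5 z - moment 6 weight * c1 - moment 7 weight * c2
      in [:c0, c1, c2:])"

lemma degree_interp: "degree (interp z) \<le> 2"
  by (simp add: interp_def Let_def)

lemma moment_weight: "k \<le> 5 \<Longrightarrow> moment k weight = (if k = 5 then 1 else 0)"
  using weight_sum[of "monom 1 k"]
  by (simp add: moment_def poly_monom degree_monom_eq mult.commute)

lemma degree_le_2_eq:
  fixes R :: "complex poly"
  assumes "degree R \<le> 2"
  shows "R = [:coeff R 0, coeff R 1, coeff R 2:]"
proof (rule poly_eqI)
  fix n
  show "coeff R n = coeff [:coeff R 0, coeff R 1, coeff R 2:] n"
    using assms coeff_eq_0[of R n]
    by (cases "n \<le> 2") (auto simp: le_Suc_eq numeral_2_eq_2 coeff_pCons split: nat.splits)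
qed

lemma moment_poly:
  "moment k (\<lambda>i. weight i * poly [:c0, c1, c2:] (a i)) =
     c0 * moment k weight + c1 * moment (Suc k) weight + c2 * moment (Suc (Suc k)) weight"
  by (simp add: moment_def sum_distrib_left sum.distrib[symmetric] algebra_simps)

lemma interp_poly:
  assumes "degree R \<le> 2"
  shows "interp (\<lambda>i. weight i * poly R (a i)) = R"
proof -
  obtain c0 c1 c2 where R: "R = [:c0, c1, c2:]"
    using degree_le_2_eq[OF assms] by blast
  show ?thesis
    unfolding R interp_def Let_def moment_poly
    by (simp add: moment_weight)
qed

lemma moment_poly_eq_0:
  assumes "degree R \<le> 2" "k < 3"
  shows "moment k (\<lambda>i. weight i * poly R (a i)) = 0"
proof -
  obtain c0 c1 c2 where R: "R = [:c0, c1, c2:]"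
    using degree_le_2_eq[OF assms(1)] by blast
  show ?thesis
    using assms(2) unfolding R moment_poly by (simp add: moment_weight)
qed

text \<open>
  The two sides have the same moments of order at most 5: for orders 3 to 5 this is the triangular
  system defining \<open>interp\<close>, for orders 0 to 2 both vanish.
\<close>

lemma interp_correct:
  assumes "\<And>k. k < 3 \<Longrightarrow> moment k z = 0"
  shows "z i = weight i * poly (interp z) (a i)"
proof -
  define y where "y = (\<lambda>i. weight i * poly (interp z) (a i))"
  have "moment k (\<lambda>i. z i - y i) = 0" if "k \<le> 5" for k
  proof -
    have "moment k z = moment k y"
    proof (cases "k < 3")
      case True
      then show ?thesis
        using moment_poly_eq_0[OF degree_interp] assms by (simp add: y_def)
    next
      case False
      then have "k = 3 \<or> k = 4 \<or> k = 5" using that by auto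
      then show ?thesis
        unfolding y_def interp_def Let_def moment_poly
        by (elim disjE) (simp_all add: moment_weight)
    qed
    then show ?thesis by (simp add: moment_diff)
  qed
  from moments_determine[OF this, of i] show ?thesis by (simp add: y_def)
qed

text \<open>
  Division of \<open>F\<close> by \<open>t - e\<close> leaves a quotient of degree at most 5, to which \<open>weight_sum\<close> applies.
\<close>

lemma one_pole_sum:
  assumes "degree F \<le> 6" "e \<notin> range a"
  shows "(\<Sum>i\<in>UNIV. weight i * poly F (a i) / (a i - e))
         = poly F e * (\<Sum>i\<in>UNIV. weight i / (a i - e)) + coeff F 6"
proof -
  define K where "K = synthetic_div F e"
  have F: "F = [:- e, 1:] * K + [:poly F e:]"
    by (simp only: K_def synthetic_div_correct')
  have K: "degree K \<le> 5"
    using assms(1) by (simp add: K_def degree_synthetic_div)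
  then have "coeff K 6 = 0" by (intro coeff_eq_0) auto
  then have c: "coeff F 6 = coeff K 5"
    by (subst F) (simp add: eval_nat_numeral)
  have "weight i * poly F (a i) / (a i - e)
      = weight i * poly K (a i) + poly F e * (weight i / (a i - e))" for i
  proof -
    have "poly F (a i) = (a i - e) * poly K (a i) + poly F e"
      by (subst F) (simp add: algebra_simps)
    moreover have "a i - e \<noteq> 0" using assms(2) by auto
    ultimately show ?thesis by (simp add: add_divide_distrib distrib_left)
  qed
  then show ?thesis
    using weight_sum[OF K] by (simp add: sum.distrib sum_distrib_left c)
qed

text \<open>
  Taking \<open>F\<close> to be the monic polynomial \<open>A\<close> with roots \<open>a i\<close> in \<open>one_pole_sum\<close> shows that the sum is
  \<open>- 1 / A(e)\<close>.
\<close>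

lemma pole_sum_nonzero:
  assumes "e \<notin> range a"
  shows "(\<Sum>i\<in>UNIV. weight i / (a i - e)) \<noteq> 0"
proof -
  define F where "F = (\<Prod>j\<in>UNIV. [:- a j, 1:])"
  have deg: "degree F = 6"
    unfolding F_def by (subst degree_prod_eq_sum_degree) auto
  have "lead_coeff F = 1"
    unfolding F_def by (subst lead_coeff_prod) auto
  then have lc: "coeff F 6 = 1" by (simp add: deg)
  have "poly F (a i) = 0" for i
    by (auto simp: F_def poly_prod prod_zero_iff)
  then show ?thesis
    using one_pole_sum[of F e] assms deg lc by auto
qed

text \<open>
  The residue theorem for \<open>F / (A (t - e\<^sub>1) (t - e\<^sub>2))\<close>, obtained from two simple poles by partial
  fractions; the two contributions of the coefficient of \<open>t\<^sup>6\<close> cancel.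
\<close>

lemma two_pole_sum:
  assumes "e1 \<noteq> e2" "e1 \<notin> range a" "e2 \<notin> range a" "c \<noteq> 0"
  obtains g1 g2 where "g1 \<noteq> 0" "g2 \<noteq> 0"
    "\<And>F. degree F \<le> 6 \<Longrightarrow>
       (\<Sum>i\<in>UNIV. weight i * poly F (a i) / (c * (a i - e1) * (a i - e2)))
       = g1 * poly F e1 + g2 * poly F e2"
proof
  let ?g = "\<lambda>e. \<Sum>i\<in>UNIV. weight i / (a i - e)"
  let ?d = "c * (e1 - e2)"
  show "?g e1 / ?d \<noteq> 0" "- ?g e2 / ?d \<noteq> 0"
    using assms pole_sum_nonzero by auto
  fix F :: "complex poly" assume F: "degree F \<le> 6"
  have "weight i * poly F (a i) / (c * (a i - e1) * (a i - e2))
      = (weight i * poly F (a i) / (a i - e1) - weight i * poly F (a i) / (a i - e2)) / ?d" for i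
  proof -
    have "a i - e1 \<noteq> 0" "a i - e2 \<noteq> 0" "e1 - e2 \<noteq> 0" using assms by auto
    then show ?thesis using \<open>c \<noteq> 0\<close> by (simp add: divide_simps) (simp add: algebra_simps)
  qed
  then have "(\<Sum>i\<in>UNIV. weight i * poly F (a i) / (c * (a i - e1) * (a i - e2)))
     = ((\<Sum>i\<in>UNIV. weight i * poly F (a i) / (a i - e1)) - (\<Sum>i\<in>UNIV. weight i * poly F (a i) / (a i - e2))) / ?d"
    by (simp only: sum_divide_distrib diff_divide_distrib sum_subtractf)
  also have "\<dots> = ?g e1 / ?d * poly F e1 + - ?g e2 / ?d * poly F e2"
    unfolding one_pole_sum[OF F assms(2)] one_pole_sum[OF F assms(3)]
    by (simp add: diff_divide_distrib add_divide_distrib mult.commute)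
  finally show "(\<Sum>i\<in>UNIV. weight i * poly F (a i) / (c * (a i - e1) * (a i - e2)))
     = ?g e1 / ?d * poly F e1 + - ?g e2 / ?d * poly F e2" .
qed

end

section \<open>Diagonal quadratic forms on a pencil of lines\<close>

text \<open>
  The linear forms \<open>r1\<close>, \<open>r2\<close> vanish at \<open>p\<close> and are homogeneous coordinates on the pencil of lines through
  \<open>p\<close> in the projective plane of \<open>T\<close>; \<open>v1\<close> and \<open>v2\<close> are the dual basis of a complement of \<open>p\<close>.
\<close>

locale pencil_in_plane =
  fixes T :: "(complex^'n) set" and p :: "complex^'n"
    and r1 r2 :: "complex^'n \<Rightarrow> complex" and v1 v2 :: "complex^'n"
  assumes subspace_T: "vec.subspace T" and p_in: "p \<in> T" and p_nz: "p \<noteq> 0"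
    and r1_add: "r1 (x + y) = r1 x + r1 y" and r1_scale: "r1 (c *s x) = c * r1 x"
    and r2_add: "r2 (x + y) = r2 x + r2 y" and r2_scale: "r2 (c *s x) = c * r2 x"
    and r_p: "r1 p = 0" "r2 p = 0"
    and v_in: "v1 \<in> T" "v2 \<in> T"
    and r_v: "r1 v1 = 1" "r2 v1 = 0" "r1 v2 = 0" "r2 v2 = 1"
    and kernel: "v \<in> T \<Longrightarrow> r1 v = 0 \<Longrightarrow> r2 v = 0 \<Longrightarrow> v \<in> vec.span {p}"
begin

definition lines :: "(complex^'n) set set" where
  "lines = {L. vec.subspace L \<and> vec.dim L = 2 \<and> p \<in> L \<and> L \<subseteq> T}"

definition cut :: "complex \<Rightarrow> complex \<Rightarrow> (complex^'n) set set" where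
  "cut \<alpha> \<beta> = {L \<in> lines. \<forall>t\<in>L. \<alpha> * (r1 t)\<^sup>2 + \<beta> * (r2 t)\<^sup>2 = 0}"

definition pairs :: "(complex^'n) set set set" where
  "pairs = {cut \<alpha> \<beta> | \<alpha> \<beta>. \<alpha> \<noteq> 0 \<or> \<beta> \<noteq> 0}"

text \<open>
  The reflection of the ambient space that fixes \<open>p\<close> and \<open>v1\<close> and changes the sign of \<open>v2\<close>.
\<close>

definition flip :: "complex^'n \<Rightarrow> complex^'n" where
  "flip v = v - (2 * r2 v) *s v2"

lemma r_minus: "r1 (x - y) = r1 x - r1 y" "r2 (x - y) = r2 x - r2 y"
  using r1_add[of "x - y" y] r2_add[of "x - y" y] by (simp_all add: algebra_simps)

lemma in_span_p: "v \<in> vec.span {p} \<Longrightarrow> r1 v = 0 \<and> r2 v = 0"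
  by (auto simp: vec.span_singleton r1_scale r2_scale r_p)

lemma in_span2: "x \<in> vec.span {p, v} \<longleftrightarrow> (\<exists>c d. x = c *s p + d *s v)"
proof
  assume "x \<in> vec.span {p, v}"
  then obtain c where "x - c *s p \<in> vec.span {v}" by (auto simp: vec.span_breakdown_eq)
  then obtain d where "x - c *s p = d *s v" by (auto simp: vec.span_singleton)
  then have "x = c *s p + d *s v" by (simp add: algebra_simps)
  then show "\<exists>c d. x = c *s p + d *s v" by blast
next
  assume "\<exists>c d. x = c *s p + d *s v"
  then obtain c d where "x = c *s p + d *s v" by blast
  moreover have "c *s p \<in> vec.span {p, v}" "d *s v \<in> vec.span {p, v}"
    by (auto intro: vec.span_scale vec.span_base)
  ultimately show "x \<in> vec.span {p, v}" by (simp add: vec.span_add)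
qed

lemma span2_line:
  assumes "v \<in> T" "r1 v \<noteq> 0 \<or> r2 v \<noteq> 0"
  shows "vec.span {p, v} \<in> lines"
proof -
  have v: "v \<notin> vec.span {p}" using in_span_p assms(2) by blast
  moreover have "vec.independent {p}" using p_nz by simp
  ultimately have "vec.independent {v, p}" by (rule vec.independent_insertI)
  moreover have "v \<noteq> p" using v vec.span_base[of p "{p}"] by auto
  ultimately have "vec.dim (vec.span {p, v}) = 2"
    by (subst vec.dim_span_eq_card_independent) (auto simp: insert_commute)
  moreover have "vec.span {p, v} \<subseteq> T"
    using assms p_in subspace_T by (intro vec.span_minimal) auto
  ultimately show ?thesis
    by (simp add: lines_def vec.span_base)
qed

lemma plane_not_in_line:
  assumes "vec.dim L = 2"
  obtains v where "v \<in> L" "v \<notin> vec.span {p}"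
proof -
  have "\<not> L \<subseteq> vec.span {p}"
  proof
    assume "L \<subseteq> vec.span {p}"
    then have "vec.dim L \<le> card {p}" by (intro vec.dim_le_card) auto
    then show False using assms by simp
  qed
  then show ?thesis using that by blast
qed

text \<open>
  A line through \<open>p\<close> is spanned by \<open>p\<close> and any of its vectors outside the span of \<open>p\<close>.
\<close>

lemma lineE:
  assumes "L \<in> lines"
  obtains v where "v \<in> T" "r1 v \<noteq> 0 \<or> r2 v \<noteq> 0" "L = vec.span {p, v}"
proof -
  have L: "vec.subspace L" "vec.dim L = 2" "p \<in> L" "L \<subseteq> T"
    using assms by (auto simp: lines_def)
  obtain v where v: "v \<in> L" "v \<notin> vec.span {p}"
    using L(2) by (rule plane_not_in_line)
  then have r: "r1 v \<noteq> 0 \<or> r2 v \<noteq> 0" using kernel L(4) by blast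
  have sub: "vec.span {p, v} \<subseteq> L"
    using v L by (intro vec.span_minimal) auto
  have "vec.dim (vec.span {p, v}) = 2"
    using span2_line[of v] r v L(4) by (auto simp: lines_def)
  then have "vec.span {p, v} = L"
    using L(2) sub L(1) by (intro vec.subspace_dim_equal) auto
  then show ?thesis using that[of v] v r L(4) by auto
qed

lemma span2_eqI:
  assumes "v \<in> T" "r1 v \<noteq> 0 \<or> r2 v \<noteq> 0" "v' \<in> T" "r1 v' \<noteq> 0 \<or> r2 v' \<noteq> 0"
    and ratio: "r1 v * r2 v' = r1 v' * r2 v"
  shows "vec.span {p, v} = vec.span {p, v'}"
proof -
  have *: "vec.span {p, v} \<subseteq> vec.span {p, v'}"
    if v: "v \<in> T" "r1 v \<noteq> 0 \<or> r2 v \<noteq> 0" "v' \<in> T" "r1 v' \<noteq> 0 \<or> r2 v' \<noteq> 0"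
      and ratio: "r1 v * r2 v' = r1 v' * r2 v" for v v'
  proof -
    obtain k where k: "r1 v = k * r1 v'" "r2 v = k * r2 v'"
    proof (cases "r1 v' = 0")
      case True
      then have "r2 v' \<noteq> 0" using v by simp
      then show ?thesis using that[of "r2 v / r2 v'"] True ratio by simp
    next
      case False
      then show ?thesis using that[of "r1 v / r1 v'"] ratio by (simp add: field_simps)
    qed
    have "v - k *s v' \<in> vec.span {p}"
      using v subspace_T
      by (intro kernel) (auto simp: r_minus r1_scale r2_scale k vec.subspace_diff vec.subspace_scale)
    then obtain c where "v - k *s v' = c *s p" by (auto simp: vec.span_singleton)
    then have "v = c *s p + k *s v'" by (simp add: algebra_simps)
    then have "v \<in> vec.span {p, v'}" by (auto simp: in_span2)
    then show ?thesis by (intro vec.span_minimal) (auto intro: vec.span_base)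
  qed
  show ?thesis using *[of v v'] *[of v' v] assms by auto
qed

lemma flip_in: "v \<in> T \<Longrightarrow> flip v \<in> T"
  using v_in subspace_T by (simp add: flip_def vec.subspace_diff vec.subspace_scale)

lemma r_flip: "r1 (flip v) = r1 v" "r2 (flip v) = - r2 v"
  by (simp_all add: flip_def r_minus r1_scale r2_scale r_v)

lemma linear_flip: "Vector_Spaces.linear (*s) (*s) flip"
  by unfold_locales
     (auto simp: flip_def r2_add r2_scale vec_eq_iff algebra_simps)

lemma flip_p: "flip p = p"
  by (simp add: flip_def r_p)

lemma flip_flip: "flip (flip v) = v"
  by (simp add: flip_def r_minus r2_scale r_v vec_eq_iff)

lemma flip_span2: "flip ` vec.span {p, v} = vec.span {p, flip v}"
  using vec.linear_span_image[OF linear_flip, of "{p, v}"] by (simp add: flip_p)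

lemma flip_line: "L \<in> lines \<Longrightarrow> flip ` L \<in> lines"
  by (elim lineE) (auto simp: flip_span2 r_flip intro!: span2_line flip_in)

lemma span2_in_cut_iff:
  assumes "v \<in> T" "r1 v \<noteq> 0 \<or> r2 v \<noteq> 0"
  shows "vec.span {p, v} \<in> cut \<alpha> \<beta> \<longleftrightarrow> \<alpha> * (r1 v)\<^sup>2 + \<beta> * (r2 v)\<^sup>2 = 0"
proof
  assume "vec.span {p, v} \<in> cut \<alpha> \<beta>"
  moreover have "v \<in> vec.span {p, v}" by (simp add: vec.span_base)
  ultimately show "\<alpha> * (r1 v)\<^sup>2 + \<beta> * (r2 v)\<^sup>2 = 0" by (auto simp: cut_def)
next
  assume *: "\<alpha> * (r1 v)\<^sup>2 + \<beta> * (r2 v)\<^sup>2 = 0"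
  have "\<alpha> * (r1 t)\<^sup>2 + \<beta> * (r2 t)\<^sup>2 = 0" if t: "t \<in> vec.span {p, v}" for t
  proof -
    obtain c d where "t = c *s p + d *s v" using t in_span2 by auto
    then have "r1 t = d * r1 v" "r2 t = d * r2 v"
      by (simp_all add: r1_add r2_add r1_scale r2_scale r_p)
    then have "\<alpha> * (r1 t)\<^sup>2 + \<beta> * (r2 t)\<^sup>2 = d\<^sup>2 * (\<alpha> * (r1 v)\<^sup>2 + \<beta> * (r2 v)\<^sup>2)"
      by (simp add: algebra_simps power_mult_distrib)
    then show ?thesis using * by simp
  qed
  then show "vec.span {p, v} \<in> cut \<alpha> \<beta>"
    using span2_line[OF assms] by (auto simp: cut_def)
qed

text \<open>
  With these coefficients, the form at \<open>x\<close> is the difference of the squares of \<open>r1 v * r2 x\<close> and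
  \<open>r1 x * r2 v\<close>, which factors into the equations of the line of \<open>v\<close> and of its reflection.
\<close>

lemma cut_eq_pair:
  assumes v: "v \<in> T" "r1 v \<noteq> 0 \<or> r2 v \<noteq> 0"
    and \<alpha>: "\<alpha> = - (r2 v)\<^sup>2" and \<beta>: "\<beta> = (r1 v)\<^sup>2"
  shows "cut \<alpha> \<beta> = {vec.span {p, v}, flip ` vec.span {p, v}}"
proof -
  have f: "flip v \<in> T" "r1 (flip v) \<noteq> 0 \<or> r2 (flip v) \<noteq> 0"
    using v flip_in by (auto simp: r_flip)
  have "L = vec.span {p, v} \<or> L = vec.span {p, flip v}" if L: "L \<in> cut \<alpha> \<beta>" for L
  proof -
    obtain x where x: "x \<in> T" "r1 x \<noteq> 0 \<or> r2 x \<noteq> 0" "L = vec.span {p, x}"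
      using L lineE by (auto simp: cut_def)
    then have "(r1 v * r2 x)\<^sup>2 = (r1 x * r2 v)\<^sup>2"
      using L span2_in_cut_iff[of x \<alpha> \<beta>] by (simp add: \<alpha> \<beta> algebra_simps power_mult_distrib)
    then have "r1 v * r2 x = r1 x * r2 v \<or> r1 v * r2 x = - (r1 x * r2 v)"
      by (simp add: power2_eq_iff)
    then show ?thesis
      using span2_eqI[OF v x(1,2)] span2_eqI[OF f x(1,2)] x(3) by (auto simp: r_flip)
  qed
  moreover have "vec.span {p, v} \<in> cut \<alpha> \<beta>" "vec.span {p, flip v} \<in> cut \<alpha> \<beta>"
    using span2_in_cut_iff[OF v] span2_in_cut_iff[OF f] by (simp_all add: r_flip \<alpha> \<beta>)
  ultimately show ?thesis by (auto simp: flip_span2)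
qed

text \<open>
  Every nonzero diagonal form has the shape required in \<open>cut_eq_pair\<close>, since its coefficients have
  complex square roots.
\<close>

lemma cut_root:
  assumes "\<alpha> \<noteq> 0 \<or> \<beta> \<noteq> 0"
  obtains v where "v \<in> T" "r1 v \<noteq> 0 \<or> r2 v \<noteq> 0" "\<alpha> = - (r2 v)\<^sup>2" "\<beta> = (r1 v)\<^sup>2"
proof
  let ?v = "csqrt \<beta> *s v1 + (\<i> * csqrt \<alpha>) *s v2"
  show "?v \<in> T" using v_in subspace_T by (simp add: vec.subspace_add vec.subspace_scale)
  have r: "r1 ?v = csqrt \<beta>" "r2 ?v = \<i> * csqrt \<alpha>"
    by (simp_all add: r1_add r2_add r1_scale r2_scale r_v)
  show "r1 ?v \<noteq> 0 \<or> r2 ?v \<noteq> 0" "\<alpha> = - (r2 ?v)\<^sup>2" "\<beta> = (r1 ?v)\<^sup>2"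
    using assms by (auto simp: r power_mult_distrib)
qed

lemma pairs_eq: "pairs = {{L, flip ` L} | L. L \<in> lines}"
proof (intro equalityI subsetI)
  fix D assume "D \<in> pairs"
  then obtain \<alpha> \<beta> where "D = cut \<alpha> \<beta>" "\<alpha> \<noteq> 0 \<or> \<beta> \<noteq> 0" by (auto simp: pairs_def)
  moreover from cut_root[OF this(2)] obtain v where
    "v \<in> T" "r1 v \<noteq> 0 \<or> r2 v \<noteq> 0" "\<alpha> = - (r2 v)\<^sup>2" "\<beta> = (r1 v)\<^sup>2" .
  ultimately show "D \<in> {{L, flip ` L} | L. L \<in> lines}"
    using cut_eq_pair[of v \<alpha> \<beta>] span2_line[of v] by auto
next
  fix D assume "D \<in> {{L, flip ` L} | L. L \<in> lines}"
  then obtain L where L: "L \<in> lines" "D = {L, flip ` L}" by auto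
  from lineE[OF L(1)] obtain v where v: "v \<in> T" "r1 v \<noteq> 0 \<or> r2 v \<noteq> 0" "L = vec.span {p, v}" .
  have "D = cut (- (r2 v)\<^sup>2) ((r1 v)\<^sup>2)"
    using cut_eq_pair[of v] v L(2) by simp
  moreover have "- (r2 v)\<^sup>2 \<noteq> 0 \<or> (r1 v)\<^sup>2 \<noteq> 0" using v(2) by auto
  ultimately show "D \<in> pairs" unfolding pairs_def by blast
qed

lemma flip_flip_image: "flip ` flip ` L = L"
  by (simp add: image_comp flip_flip)

text \<open>
  The pair of \<open>L\<close> determines its second member because the reflection is an involution, so a pair
  \<open>{M, flip ` M}\<close> containing \<open>L\<close> is \<open>{L, flip ` L}\<close>. This includes fixed lines, where the pair is a singleton.
\<close>

lemma partner_pairs: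
  assumes "L \<in> lines"
  shows "partner pairs L = flip ` L"
  unfolding partner_def
proof (rule the_equality)
  show "{L, flip ` L} \<in> pairs" using assms by (auto simp: pairs_eq)
  fix L' assume "{L, L'} \<in> pairs"
  then obtain M where "{L, L'} = {M, flip ` M}" by (auto simp: pairs_eq)
  then show "L' = flip ` L"
    using flip_flip_image[of M] by (metis doubleton_eq_iff)
qed

text \<open>
  The involution is not the identity: it moves the line of \<open>v1 + v2\<close>.
\<close>

lemma involution_pairs: "involution_with_pairs lines (partner pairs) pairs"
proof -
  let ?v = "v1 + v2"
  have v: "?v \<in> T" "r1 ?v = 1" "r2 ?v = 1"
    using v_in subspace_T by (simp_all add: vec.subspace_add r1_add r2_add r_v)
  have "vec.span {p, ?v} \<noteq> flip ` vec.span {p, ?v}"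
  proof
    assume "vec.span {p, ?v} = flip ` vec.span {p, ?v}"
    moreover have "?v \<in> vec.span {p, ?v}" by (intro vec.span_base) simp
    ultimately have "flip ?v \<in> vec.span {p, ?v}" by blast
    then obtain c d where "flip ?v = c *s p + d *s ?v" by (auto simp: in_span2)
    then have "r1 (flip ?v) = d" "r2 (flip ?v) = d"
      by (simp_all add: r1_add r2_add r1_scale r2_scale r_p r_v)
    then show False using v by (simp add: r_flip)
  qed
  moreover have "vec.span {p, ?v} \<in> lines" using span2_line v by simp
  ultimately have "\<exists>L\<in>lines. flip ` L \<noteq> L" by metis
  then have "\<exists>L\<in>lines. partner pairs L \<noteq> L" by (metis partner_pairs)
  moreover have "pairs = {{L, partner pairs L} | L. L \<in> lines}"
  proof -
    have "(\<lambda>L. {L, partner pairs L}) ` lines = (\<lambda>L. {L, flip ` L}) ` lines"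
      by (intro image_cong refl) (simp add: partner_pairs)
    moreover have "pairs = (\<lambda>L. {L, flip ` L}) ` lines"
      unfolding pairs_eq by (rule Setcompr_eq_image)
    ultimately show ?thesis by (simp only: Setcompr_eq_image)
  qed
  moreover have "\<forall>L\<in>lines. partner pairs L \<in> lines \<and> partner pairs (partner pairs L) = L"
    by (simp add: partner_pairs flip_line flip_flip_image)
  moreover have "\<exists>f. Vector_Spaces.linear (*s) (*s) f \<and> (\<forall>L\<in>lines. partner pairs L = f ` L)"
    using linear_flip partner_pairs by blast
  ultimately show ?thesis
    unfolding involution_with_pairs_def by blast
qed

lemma cut_covers:
  assumes "\<alpha> \<noteq> 0 \<or> \<beta> \<noteq> 0"
  shows "{t \<in> T. \<alpha> * (r1 t)\<^sup>2 + \<beta> * (r2 t)\<^sup>2 = 0} = \<Union> (cut \<alpha> \<beta>)"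
proof (intro equalityI subsetI)
  fix t assume t: "t \<in> {t \<in> T. \<alpha> * (r1 t)\<^sup>2 + \<beta> * (r2 t)\<^sup>2 = 0}"
  show "t \<in> \<Union> (cut \<alpha> \<beta>)"
  proof (cases "r1 t = 0 \<and> r2 t = 0")
    case True
    then have "t \<in> vec.span {p}" using kernel t by auto
    moreover obtain L where "L \<in> cut \<alpha> \<beta>"
    proof -
      obtain v where "v \<in> T" "r1 v \<noteq> 0 \<or> r2 v \<noteq> 0" "\<alpha> = - (r2 v)\<^sup>2" "\<beta> = (r1 v)\<^sup>2"
        using cut_root[OF assms] .
      then have "vec.span {p, v} \<in> cut \<alpha> \<beta>" using cut_eq_pair[of v] by simp
      then show ?thesis using that by blast
    qed
    moreover have "vec.span {p} \<subseteq> L"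
      using calculation(2) by (intro vec.span_minimal) (auto simp: cut_def lines_def)
    ultimately show ?thesis by blast
  next
    case False
    then have "vec.span {p, t} \<in> cut \<alpha> \<beta>" using span2_in_cut_iff[of t] t by auto
    then show ?thesis using vec.span_base[of t "{p, t}"] by blast
  qed
qed (auto simp: cut_def lines_def)

end

section \<open>Local parametrizations of the Kummer surface\<close>

text \<open>
  Complex differentiability at a point for functions of several complex variables.
\<close>

definition holo_at :: "(complex^'m \<Rightarrow> complex) \<Rightarrow> complex^'m \<Rightarrow> bool" where
  "holo_at f s \<longleftrightarrow> (\<exists>D. (f has_derivative D) (at s) \<and> (\<forall>c v. D (c *s v) = c * D v))"

lemma holo_at_const: "holo_at (\<lambda>s. c) s"
  unfolding holo_at_def by (intro exI[of _ "\<lambda>_. 0"]) auto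

lemma has_derivative_nth: "((\<lambda>s. s $ i) has_derivative (\<lambda>v. v $ i)) (at s)"
  by (rule bounded_linear.has_derivative[OF bounded_linear_vec_nth has_derivative_ident])

lemma holo_at_nth: "holo_at (\<lambda>s. s $ i) s"
  unfolding holo_at_def by (intro exI[of _ "\<lambda>v. v $ i"] conjI has_derivative_nth) auto

lemma holo_at_add:
  assumes "holo_at f s" "holo_at g s"
  shows "holo_at (\<lambda>s. f s + g s) s"
proof -
  obtain D E where "(f has_derivative D) (at s)" "\<forall>c v. D (c *s v) = c * D v"
    "(g has_derivative E) (at s)" "\<forall>c v. E (c *s v) = c * E v"
    using assms by (auto simp: holo_at_def)
  then show ?thesis
    unfolding holo_at_def
    by (intro exI[of _ "\<lambda>v. D v + E v"]) (auto intro: has_derivative_add simp: algebra_simps)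
qed

lemma holo_at_mult:
  assumes "holo_at f s" "holo_at g s"
  shows "holo_at (\<lambda>s. f s * g s) s"
proof -
  obtain D E where "(f has_derivative D) (at s)" "\<forall>c v. D (c *s v) = c * D v"
    "(g has_derivative E) (at s)" "\<forall>c v. E (c *s v) = c * E v"
    using assms by (auto simp: holo_at_def)
  then show ?thesis
    unfolding holo_at_def
    by (intro exI[of _ "\<lambda>v. f s * E v + D v * g s"])
       (intro conjI has_derivative_mult; simp add: algebra_simps)
qed

lemma holo_at_power: "holo_at f s \<Longrightarrow> holo_at (\<lambda>s. f s ^ n) s"
  by (induction n) (auto intro: holo_at_const holo_at_mult)

lemma holo_at_compose:
  assumes "holo_at f s" "(g has_field_derivative d) (at (f s))"
  shows "holo_at (\<lambda>s. g (f s)) s"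
proof -
  obtain D where D: "(f has_derivative D) (at s)" "\<forall>c v. D (c *s v) = c * D v"
    using assms(1) by (auto simp: holo_at_def)
  have "((\<lambda>s. g (f s)) has_derivative (\<lambda>v. d * D v)) (at s)"
    using has_derivative_compose[OF D(1)] assms(2) by (simp add: has_field_derivative_def)
  then show ?thesis
    unfolding holo_at_def using D(2) by (intro exI[of _ "\<lambda>v. d * D v"]) auto
qed

lemma has_derivative_vec_of_components:
  fixes f :: "'a::real_normed_vector \<Rightarrow> complex^'n"
  assumes "\<And>i. ((\<lambda>s. f s $ i) has_derivative D i) (at s)"
  shows "(f has_derivative (\<lambda>v. \<chi> i. D i v)) (at s)"
proof (subst has_derivative_componentwise_within, intro ballI)
  fix b :: "complex^'n" assume "b \<in> Basis"
  then obtain i u where b: "b = axis i u" by (auto simp: Basis_vec_def)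
  have "((\<lambda>s. f s $ i \<bullet> u) has_derivative (\<lambda>v. D i v \<bullet> u)) (at s)"
    by (intro has_derivative_inner_left assms)
  then show "((\<lambda>x. f x \<bullet> b) has_derivative (\<lambda>x. (\<chi> i. D i x) \<bullet> b)) (at s within UNIV)"
    by (simp add: b inner_axis)
qed

lemma has_derivative_holo_components:
  fixes f :: "complex^'m \<Rightarrow> complex^'n"
  assumes "\<And>i. holo_at (\<lambda>s. f s $ i) s"
  obtains D where "(f has_derivative D) (at s)" "\<And>c v. D (c *s v) = c *s D v"
proof -
  obtain D where D: "\<And>i. ((\<lambda>s. f s $ i) has_derivative D i) (at s)" "\<And>i c v. D i (c *s v) = c * D i v"
    using assms unfolding holo_at_def by metis
  show ?thesis
    by (rule that[OF has_derivative_vec_of_components[OF D(1)]]) (simp add: vec_eq_iff D(2))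
qed

context six_points
begin

lemma quadric_eq_moment: "quadric a k x = moment k (\<lambda>i. (x $ i)\<^sup>2)"
  by (simp add: quadric_def moment_def)

lemma kummer_iff: "x \<in> kummer a \<longleftrightarrow> x \<noteq> 0 \<and> (\<forall>k<3. moment k (\<lambda>i. (x $ i)\<^sup>2) = 0)"
  by (auto simp: kummer_def quadric_eq_moment numeral_3_eq_3 less_Suc_eq numeral_2_eq_2)

lemma kummer_scale:
  assumes "x \<in> kummer a" "c \<noteq> 0"
  shows "c *s x \<in> kummer a"
  using assms by (simp add: kummer_iff power_mult_distrib moment_scale)

text \<open>
  The zeros of \<open>z\<close> are the nodes that are roots of a nonzero polynomial of degree at most 2.
\<close>

lemma card_zeros_le:
  assumes "\<And>k. k < 3 \<Longrightarrow> moment k z = 0" "z \<noteq> (\<lambda>i. 0)"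
  shows "card {i. z i = 0} \<le> 2"
proof -
  have nz: "interp z \<noteq> 0"
    using assms(2) interp_correct[of z, OF assms(1)] by (auto simp: fun_eq_iff)
  have "a ` {i. z i = 0} \<subseteq> {t. poly (interp z) t = 0}"
    using interp_correct[of z, OF assms(1)] weight_nonzero by auto
  then have "card (a ` {i. z i = 0}) \<le> card {t. poly (interp z) t = 0}"
    by (intro card_mono poly_roots_finite nz)
  also have "\<dots> \<le> degree (interp z)" by (intro card_poly_roots_bound nz)
  also have "\<dots> \<le> 2" by (rule degree_interp)
  finally show ?thesis using inj_a by (simp add: card_image inj_on_subset[of a UNIV])
qed

lemma three_zeros:
  assumes "\<And>k. k < 3 \<Longrightarrow> moment k z = 0" "z l = 0" "z m = 0" "z n = 0" "l \<noteq> m" "l \<noteq> n" "m \<noteq> n"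
  shows "z i = 0"
proof (rule ccontr)
  assume "z i \<noteq> 0"
  then have "card {i. z i = 0} \<le> 2" by (intro card_zeros_le assms) auto
  moreover have "card {l, m, n} \<le> card {i. z i = 0}"
    using assms by (intro card_mono) auto
  ultimately show False using assms by simp
qed

lemma kernel_vector:
  assumes "l \<noteq> m" "l \<noteq> n" "m \<noteq> n"
  obtains \<beta> where "\<And>k. k < 3 \<Longrightarrow> moment k \<beta> = 0" "\<beta> m = 1" "\<beta> n = 0" "\<beta> l = 0"
proof -
  define R where "R = [:- a n, 1:] * [:- a l, 1:]"
  define d where "d = weight m * poly R (a m)"
  have d: "d \<noteq> 0"
    unfolding d_def R_def poly_mult using assms inj_a weight_nonzero[of m] by (simp add: inj_eq)
  have R: "degree R \<le> 2" by (simp add: R_def)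
  show ?thesis
  proof
    show "moment k (\<lambda>i. (1 / d) * (weight i * poly R (a i))) = 0" if "k < 3" for k
      using that moment_poly_eq_0[OF R] by (subst moment_scale) simp
  qed (use d in \<open>auto simp: d_def R_def\<close>)
qed

text \<open>
  At most two coordinates of a point of the surface vanish; \<open>m\<close> and \<open>n\<close> include their indices.
\<close>

lemma coordinates_nonzero:
  assumes "p \<in> kummer a"
  obtains l m n where "l \<noteq> m" "l \<noteq> n" "m \<noteq> n" "\<And>i. i \<noteq> m \<Longrightarrow> i \<noteq> n \<Longrightarrow> p $ i \<noteq> 0"
proof -
  let ?Z = "{i. (p $ i)\<^sup>2 = 0}"
  have "card ?Z \<le> 2"
    using assms by (intro card_zeros_le) (auto simp: kummer_iff vec_eq_iff fun_eq_iff)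
  then obtain S where S: "?Z \<subseteq> S" "card S = 2"
    using exists_subset_between[of ?Z 2 UNIV] by auto
  then obtain m n where mn: "S = {m, n}" "m \<noteq> n" by (auto simp: card_2_iff)
  have "S \<noteq> UNIV" using S by auto
  then obtain l where "l \<notin> S" by auto
  then show ?thesis using S(1) mn that[of l m n] by auto
qed

lemma Re_pos_power2_eq:
  assumes "(x::complex)\<^sup>2 = y\<^sup>2" "Re x > 0" "Re y > 0"
  shows "x = y"
  using assms by (auto simp: power2_eq_iff)

lemma Re_csqrt_pos:
  assumes "Re u > 0"
  shows "Re (csqrt u) > 0"
proof -
  have "Re ((csqrt u)\<^sup>2) = (Re (csqrt u))\<^sup>2 - (Im (csqrt u))\<^sup>2"
    by (simp add: power2_eq_square del: power2_csqrt)
  then have "(Re (csqrt u))\<^sup>2 > 0"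
    using assms by (smt (verit) power2_csqrt zero_le_power2)
  moreover have "Re (csqrt u) \<ge> 0"
    using csqrt_principal[of u] by auto
  ultimately show ?thesis by (smt (verit) zero_eq_power2)
qed

text \<open>
  The equations are linear in the squares of the coordinates. Normalizing the coordinate \<open>l\<close> and
  choosing the coordinates \<open>m\<close> and \<open>n\<close> freely determines the remaining squares, and near \<open>p\<close> the
  remaining coordinates are the branches of the square root close to those of \<open>p\<close>. All coordinates
  that vanish at \<open>p\<close> are among the two free ones, so no square root is taken near 0. The branch
  is singled out by a positive real part of \<open>x i / p i\<close>, an open condition; this makes the
  parametrization open.
\<close>

lemma local_param_exists:
  assumes p: "p \<in> kummer a"
  shows "\<exists>\<phi>. local_param (kummer a) p \<phi>"
proof -
  obtain l m n where lmn: "l \<noteq> m" "l \<noteq> n" "m \<noteq> n"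
    and nz: "\<And>i. i \<noteq> m \<Longrightarrow> i \<noteq> n \<Longrightarrow> p $ i \<noteq> 0"
    using coordinates_nonzero[OF p] by blast
  obtain \<beta> where \<beta>: "\<And>k. k < 3 \<Longrightarrow> moment k \<beta> = 0" "\<beta> m = 1" "\<beta> n = 0" "\<beta> l = 0"
    using kernel_vector[OF lmn] by blast
  obtain \<gamma> where \<gamma>: "\<And>k. k < 3 \<Longrightarrow> moment k \<gamma> = 0" "\<gamma> n = 1" "\<gamma> m = 0" "\<gamma> l = 0"
    using kernel_vector[of l n m] lmn by metis
  have pl: "p $ l \<noteq> 0" using nz lmn by auto
  \<comment> \<open>The squares of the coordinates, affine in the increments of the squares of the coordinates
    \<open>m\<close> and \<open>n\<close>; the vectors \<open>\<beta>\<close> and \<open>\<gamma>\<close> restore the three equations and leave the coordinate \<open>l\<close> fixed.\<close>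
  define y where "y s i = (p $ i)\<^sup>2 + ((2 * p $ m * s $ 1 + (s $ 1)\<^sup>2) * \<beta> i + (2 * p $ n * s $ 2 + (s $ 2)\<^sup>2) * \<gamma> i)"
    for s :: "complex^2" and i
  define \<phi> where "\<phi> s = (\<chi> i. if i = m then p $ m + s $ 1 else if i = n then p $ n + s $ 2
      else p $ i * csqrt (y s i / (p $ i)\<^sup>2))" for s :: "complex^2"
  define U where "U = {s. \<forall>i\<in>UNIV - {m, n}. Re (y s i / (p $ i)\<^sup>2) > 0}"
  have y_moment: "moment k (y s) = 0" if "k < 3" for k s
    using that p \<beta>(1) \<gamma>(1) unfolding y_def moment_add moment_scale by (simp add: kummer_iff)
  have y_sq: "(\<phi> s $ i)\<^sup>2 = y s i" for s i
    using nz[of i] \<beta> \<gamma> by (auto simp: \<phi>_def y_def power2_sum power_mult_distrib)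
  have \<phi>_m: "\<phi> s $ m = p $ m + s $ 1" and \<phi>_n: "\<phi> s $ n = p $ n + s $ 2" for s
    using lmn by (auto simp: \<phi>_def)
  have \<phi>_l: "\<phi> s $ l = p $ l" for s
    using lmn pl \<beta> \<gamma> by (simp add: \<phi>_def y_def)
  have \<phi>_X: "\<phi> s \<in> kummer a" for s
    using y_moment \<phi>_l[of s] pl by (auto simp: kummer_iff y_sq)
  have cont_y: "continuous_on UNIV (\<lambda>s. Re (y s i / (p $ i)\<^sup>2))" if "p $ i \<noteq> 0" for i
    unfolding y_def using that by (intro continuous_intros) auto
  have "open U"
  proof -
    have "U = (\<Inter>i\<in>UNIV - {m, n}. {s. 0 < Re (y s i / (p $ i)\<^sup>2)})" by (auto simp: U_def)
    moreover have "open {s. 0 < Re (y s i / (p $ i)\<^sup>2)}" if "i \<in> UNIV - {m, n}" for i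
      using that by (intro open_Collect_less continuous_on_const cont_y nz) auto
    ultimately show ?thesis by (auto intro!: open_INT)
  qed
  have y0: "y 0 i = (p $ i)\<^sup>2" for i by (simp add: y_def)
  have "0 \<in> U" using nz by (auto simp: U_def y0)
  have "\<phi> 0 = p" using nz by (auto simp: \<phi>_def y0 vec_eq_iff)
  have \<phi>_re: "Re (\<phi> s $ i / p $ i) > 0" if "s \<in> U" "i \<noteq> m" "i \<noteq> n" for s i
  proof -
    have "\<phi> s $ i / p $ i = csqrt (y s i / (p $ i)\<^sup>2)" using that nz[of i] by (simp add: \<phi>_def)
    moreover have "Re (y s i / (p $ i)\<^sup>2) > 0" using that by (auto simp: U_def)
    ultimately show ?thesis using Re_csqrt_pos by simp
  qed
  have holo: "holo_at (\<lambda>s. \<phi> s $ i) s" if "s \<in> U" for s i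
  proof -
    consider "i = m" | "i = n" | "i \<noteq> m" "i \<noteq> n" by blast
    then show ?thesis
    proof cases
      case 3
      have "Re (y s i / (p $ i)\<^sup>2) > 0" using 3 that by (auto simp: U_def)
      then have nn: "y s i / (p $ i)\<^sup>2 \<notin> \<real>\<^sub>\<le>\<^sub>0" by (auto simp: complex_nonpos_Reals_iff)
      have "holo_at (\<lambda>s. y s i / (p $ i)\<^sup>2) s"
        unfolding y_def divide_inverse
        by (intro holo_at_add holo_at_mult holo_at_const holo_at_nth holo_at_power)
      then have "holo_at (\<lambda>s. csqrt (y s i / (p $ i)\<^sup>2)) s"
        by (rule holo_at_compose[where g = csqrt]) (rule has_field_derivative_csqrt[OF nn])
      then show ?thesis
        using 3 by (auto simp: \<phi>_def intro: holo_at_mult holo_at_const)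
    qed (auto simp: \<phi>_m \<phi>_n intro: holo_at_add holo_at_const holo_at_nth)
  qed
  have deriv: "\<exists>D. (\<phi> has_derivative D) (at s) \<and> (\<forall>c v. D (c *s v) = c *s D v) \<and>
                 (\<forall>v. D v \<in> vec.span {\<phi> s} \<longrightarrow> v = 0)" if s: "s \<in> U" for s
  proof -
    obtain D where D: "(\<phi> has_derivative D) (at s)" "\<And>c v. D (c *s v) = c *s D v"
      using has_derivative_holo_components[OF holo[OF s]] by blast
    have comp: "((\<lambda>s. \<phi> s $ i) has_derivative (\<lambda>v. D v $ i)) (at s)" for i
      by (rule bounded_linear.has_derivative[OF bounded_linear_vec_nth D(1)])
    have "(\<lambda>v. D v $ l) = (\<lambda>v. 0)"
      using comp[of l] unfolding \<phi>_l by (rule has_derivative_unique) simp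
    moreover have "((\<lambda>s. c + s $ j) has_derivative (\<lambda>v. v $ j)) (at s)" for c and j :: 2
      using has_derivative_add[OF has_derivative_const has_derivative_nth] by simp
    then have "(\<lambda>v. D v $ m) = (\<lambda>v. v $ 1)" "(\<lambda>v. D v $ n) = (\<lambda>v. v $ 2)"
      using comp[of m] comp[of n] unfolding \<phi>_m \<phi>_n by (auto intro: has_derivative_unique)
    ultimately have Dc: "D v $ l = 0" "D v $ m = v $ 1" "D v $ n = v $ 2" for v
      by (auto dest: fun_cong)
    have "v = 0" if v: "D v \<in> vec.span {\<phi> s}" for v
    proof -
      obtain c where c: "D v = c *s \<phi> s" using v by (auto simp: vec.span_singleton)
      then have "c * p $ l = 0" using Dc(1)[of v] by (simp add: \<phi>_l)
      then have "D v = 0" using c pl by simp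
      then show "v = 0" using Dc(2,3)[of v] by (simp add: vec_eq_iff forall_2)
    qed
    then show ?thesis using D by blast
  qed
  have inj: "s = t" if "\<phi> s = c *s \<phi> t" for s t c
  proof -
    have "p $ l = c * p $ l" using that \<phi>_l by (metis vector_smult_component)
    then have "c = 1" using pl by simp
    then have "\<phi> s = \<phi> t" using that by simp
    then have "p $ m + s $ 1 = p $ m + t $ 1" "p $ n + s $ 2 = p $ n + t $ 2"
      using \<phi>_m \<phi>_n by metis+
    then show ?thesis by (simp add: vec_eq_iff forall_2)
  qed
  have opn: "openin (top_of_set (kummer a)) {c *s \<phi> s | c s. c \<noteq> 0 \<and> s \<in> W}"
    if W: "open W" "W \<subseteq> U" for W
  proof -
    \<comment> \<open>The inverse of the parametrization, after rescaling \<open>x\<close> to have the coordinate \<open>l\<close> of \<open>p\<close>.\<close>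
    define \<psi> where "\<psi> x = (\<chi> j. if j = 1 then p $ l * x $ m / x $ l - p $ m else p $ l * x $ n / x $ l - p $ n :: complex^2)"
      for x :: "complex^6"
    define A where "A = {x :: complex^6. x $ l \<noteq> 0}"
    define B where "B = A \<inter> (\<lambda>x. (\<psi> x, \<chi> i. Re (x $ i * p $ l / (x $ l * p $ i)))) -`
       (W \<times> (\<Inter>i\<in>UNIV - {m, n}. {u :: real^6. 0 < u $ i}))"
    have "open A" unfolding A_def
      by (intro open_Collect_neq continuous_intros)
    have "open B"
      unfolding B_def
    proof (rule continuous_open_preimage)
      have "continuous_on A (\<lambda>x. Re (x $ i * p $ l / (x $ l * p $ i)))" for i
        by (cases "p $ i = 0") (auto simp: A_def intro!: continuous_intros)
      moreover have "continuous_on A \<psi>"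
        unfolding \<psi>_def
      proof (intro continuous_on_vec_lambda)
        fix j :: 2
        show "continuous_on A (\<lambda>x. if j = 1 then p $ l * x $ m / x $ l - p $ m
            else p $ l * x $ n / x $ l - p $ n)"
          by (cases "j = 1") (auto simp: A_def intro!: continuous_intros)
      qed
      ultimately show "continuous_on A (\<lambda>x. (\<psi> x, \<chi> i. Re (x $ i * p $ l / (x $ l * p $ i))))"
        by (intro continuous_on_Pair continuous_on_vec_lambda)
      show "open (W \<times> (\<Inter>i\<in>UNIV - {m, n}. {u :: real^6. 0 < u $ i}))"
        by (intro open_Times W open_INT ballI open_Collect_less continuous_intros) auto
    qed fact
    have B: "x \<in> B \<longleftrightarrow> x $ l \<noteq> 0 \<and> \<psi> x \<in> W \<and> (\<forall>i. i \<noteq> m \<and> i \<noteq> n \<longrightarrow> Re (x $ i * p $ l / (x $ l * p $ i)) > 0)"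
      for x by (auto simp: B_def A_def)
    have "{c *s \<phi> s | c s. c \<noteq> 0 \<and> s \<in> W} = kummer a \<inter> B"
    proof (intro equalityI subsetI)
      fix x assume "x \<in> {c *s \<phi> s | c s. c \<noteq> 0 \<and> s \<in> W}"
      then obtain c s where x: "x = c *s \<phi> s" "c \<noteq> 0" "s \<in> W" by auto
      have "\<psi> x = s" using x(2) pl by (simp add: x(1) \<psi>_def \<phi>_l \<phi>_m \<phi>_n vec_eq_iff forall_2)
      moreover have "x $ i * p $ l / (x $ l * p $ i) = \<phi> s $ i / p $ i" for i
        using x(2) pl by (simp add: x(1) \<phi>_l)
      ultimately show "x \<in> kummer a \<inter> B"
        using x W(2) \<phi>_re kummer_scale[OF \<phi>_X x(2)] pl by (auto simp: B \<phi>_l)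
    next
      fix x assume x: "x \<in> kummer a \<inter> B"
      then have xl: "x $ l \<noteq> 0" and sW: "\<psi> x \<in> W" by (auto simp: B)
      define x' where "x' = (p $ l / x $ l) *s x"
      have x': "x' \<in> kummer a" unfolding x'_def using x xl pl by (intro kummer_scale) auto
      have co: "x' $ l = p $ l" "x' $ m = p $ m + \<psi> x $ 1" "x' $ n = p $ n + \<psi> x $ 2"
        using xl by (simp_all add: x'_def \<psi>_def)
      define z where "z i = (x' $ i)\<^sup>2 - (\<phi> (\<psi> x) $ i)\<^sup>2" for i
      have z: "z i = 0" for i
      proof (rule three_zeros[of z l m n])
        show "moment k z = 0" if "k < 3" for k
          using that x' \<phi>_X[of "\<psi> x"] unfolding z_def moment_diff by (simp add: kummer_iff)
      qed (use lmn in \<open>auto simp: z_def co \<phi>_l \<phi>_m \<phi>_n\<close>)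
      have "x' $ i = \<phi> (\<psi> x) $ i" for i
      proof (cases "i = m \<or> i = n")
        case True
        then show ?thesis using co \<phi>_m \<phi>_n by auto
      next
        case False
        have "x' $ i / p $ i = \<phi> (\<psi> x) $ i / p $ i"
        proof (rule Re_pos_power2_eq)
          show "(x' $ i / p $ i)\<^sup>2 = (\<phi> (\<psi> x) $ i / p $ i)\<^sup>2"
            using z[of i] by (simp add: z_def power_divide)
          have "x' $ i / p $ i = x $ i * p $ l / (x $ l * p $ i)" by (simp add: x'_def)
          then show "0 < Re (x' $ i / p $ i)" using x False by (auto simp: B)
          show "0 < Re (\<phi> (\<psi> x) $ i / p $ i)" using \<phi>_re[of "\<psi> x" i] sW W(2) False by auto
        qed
        then show ?thesis using nz False by simp
      qed
      then have "x' = \<phi> (\<psi> x)" by (simp add: vec_eq_iff)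
      moreover have "x = (x $ l / p $ l) *s x'"
        using xl pl by (simp add: x'_def vec_eq_iff)
      ultimately have "x = (x $ l / p $ l) *s \<phi> (\<psi> x)" by simp
      then show "x \<in> {c *s \<phi> s | c s. c \<noteq> 0 \<and> s \<in> W}"
        using sW xl pl by (intro CollectI exI[of _ "x $ l / p $ l"] exI[of _ "\<psi> x"]) auto
    qed
    then show ?thesis using \<open>open B\<close> by (auto simp: openin_open)
  qed
  have "local_param (kummer a) p \<phi>"
    unfolding local_param_def
  proof (intro exI[of _ U] conjI)
    show "\<phi> ` U \<subseteq> kummer a" using \<phi>_X by auto
    show "\<forall>s\<in>U. \<forall>t\<in>U. \<forall>c. \<phi> s = c *s \<phi> t \<longrightarrow> s = t" using inj by blast
  qed (use \<open>open U\<close> \<open>0 \<in> U\<close> \<open>\<phi> 0 = p\<close> deriv opn in auto)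
  then show ?thesis by blast
qed

end

section \<open>Forms and the identity theorem\<close>

lemma form_coordinate: "form 1 (\<lambda>x :: complex^'n. x $ i)"
proof -
  define \<delta> where "\<delta> = (\<lambda>j. if j = i then 1 else 0 :: nat)"
  let ?M = "{m :: 'n \<Rightarrow> nat. (\<Sum>j\<in>UNIV. m j) = 1}"
  have \<delta>: "\<delta> \<in> ?M" by (simp add: \<delta>_def)
  have "x $ i = (\<Sum>m\<in>?M. (if m = \<delta> then 1 else 0) * (\<Prod>j\<in>UNIV. (x $ j) ^ m j))"
    for x :: "complex^'n"
  proof -
    have "(\<Sum>m\<in>?M. (if m = \<delta> then 1 else 0) * (\<Prod>j\<in>UNIV. (x $ j) ^ m j))
       = (\<Sum>m\<in>?M. if m = \<delta> then \<Prod>j\<in>UNIV. (x $ j) ^ \<delta> j else 0)"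
      by (intro sum.cong) auto
    also have "\<dots> = (\<Prod>j\<in>UNIV. (x $ j) ^ \<delta> j)"
      using finite_exponents[where 'n = 'n and d = 1] \<delta> by simp
    also have "\<dots> = (\<Prod>j\<in>UNIV. if j = i then x $ i else 1)"
      by (intro prod.cong) (auto simp: \<delta>_def)
    finally show ?thesis by simp
  qed
  then show ?thesis
    unfolding form_def by (intro exI[of _ "\<lambda>m. if m = \<delta> then 1 else 0"] allI)
qed

lemma form_scale:
  assumes "form d F"
  shows "form d (\<lambda>x. c * F x)"
proof -
  obtain e where "\<forall>x. F x = (\<Sum>m | (\<Sum>i\<in>UNIV. m i) = d. e m * (\<Prod>i\<in>UNIV. (x $ i) ^ m i))"
    using assms by (auto simp: form_def)
  then show ?thesis
    unfolding form_def by (intro exI[of _ "\<lambda>m. c * e m"]) (simp add: sum_distrib_left mult.assoc)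
qed

lemma form_add:
  assumes "form d F" "form d G"
  shows "form d (\<lambda>x. F x + G x)"
proof -
  obtain e f where "\<forall>x. F x = (\<Sum>m | (\<Sum>i\<in>UNIV. m i) = d. e m * (\<Prod>i\<in>UNIV. (x $ i) ^ m i))"
    "\<forall>x. G x = (\<Sum>m | (\<Sum>i\<in>UNIV. m i) = d. f m * (\<Prod>i\<in>UNIV. (x $ i) ^ m i))"
    using assms by (auto simp: form_def)
  then show ?thesis
    unfolding form_def
    by (intro exI[of _ "\<lambda>m. e m + f m"]) (simp add: sum.distrib distrib_right)
qed

lemma form_diff: "form d F \<Longrightarrow> form d G \<Longrightarrow> form d (\<lambda>x. F x - G x)"
  using form_add[of d F "\<lambda>x. (-1) * G x"] form_scale[of d G "-1"] by simp

lemma form_zero: "form d (\<lambda>x. 0)"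
  unfolding form_def by (intro exI[of _ "\<lambda>_. 0"]) simp

lemma form_sum: "(\<And>i. i \<in> A \<Longrightarrow> form d (F i)) \<Longrightarrow> form d (\<lambda>x. \<Sum>i\<in>A. F i x)"
  by (induction A rule: infinite_finite_induct) (auto intro: form_zero form_add)

text \<open>
  The coefficients of the product are the convolution of those of the factors.
\<close>

lemma form_mult:
  fixes F G :: "complex^'n \<Rightarrow> complex"
  assumes "form d F" "form e G"
  shows "form (d + e) (\<lambda>x. F x * G x)"
proof -
  let ?M = "\<lambda>d. {m :: 'n \<Rightarrow> nat. (\<Sum>i\<in>UNIV. m i) = d}"
  let ?mono = "\<lambda>m (x :: complex^'n). \<Prod>i\<in>UNIV. (x $ i) ^ m i"
  obtain u v where u: "\<And>x. F x = (\<Sum>m\<in>?M d. u m * ?mono m x)"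
    and v: "\<And>x. G x = (\<Sum>m\<in>?M e. v m * ?mono m x)"
    using assms unfolding form_def by blast
  define w where "w k = (\<Sum>mn\<in>{mn \<in> ?M d \<times> ?M e. fst mn + snd mn = k}. u (fst mn) * v (snd mn))" for k
  have "F x * G x = (\<Sum>k\<in>?M (d + e). w k * ?mono k x)" for x
  proof -
    have "F x * G x = (\<Sum>mn\<in>?M d \<times> ?M e. u (fst mn) * v (snd mn) * ?mono (fst mn + snd mn) x)"
      unfolding u v sum_product sum.cartesian_product
      by (intro sum.cong) (auto simp: power_add prod.distrib)
    also have "\<dots> = (\<Sum>k\<in>?M (d + e). \<Sum>mn\<in>{mn \<in> ?M d \<times> ?M e. fst mn + snd mn = k}.
        u (fst mn) * v (snd mn) * ?mono (fst mn + snd mn) x)"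
      by (intro sum.group[symmetric] finite_cartesian_product finite_exponents)
         (auto simp: sum.distrib)
    also have "\<dots> = (\<Sum>k\<in>?M (d + e). w k * ?mono k x)"
      unfolding w_def sum_distrib_right by (intro sum.cong refl) auto
    finally show ?thesis .
  qed
  then show ?thesis unfolding form_def by (intro exI[of _ w] allI)
qed

lemma form_const: "form 0 (\<lambda>x :: complex^'n. c)"
proof -
  have eq: "{m :: 'n \<Rightarrow> nat. (\<Sum>i\<in>UNIV. m i) = 0} = {\<lambda>_. 0}" by auto
  show ?thesis unfolding form_def eq by (intro exI[of _ "\<lambda>_. c"]) simp
qed

lemma form_power: "form d F \<Longrightarrow> form (n * d) (\<lambda>x. F x ^ n)"
  by (induction n) (auto intro: form_const form_mult)

lemma form_prod_coordinates: "finite A \<Longrightarrow> form (card A) (\<lambda>x :: complex^'n. \<Prod>i\<in>A. x $ i)"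
proof (induction A rule: finite_induct)
  case (insert i A)
  then show ?case using form_mult[OF form_coordinate[of i] insert.IH] by simp
qed (simp add: form_const)

lemma form_homogeneous:
  assumes "form d F"
  shows "F (c *s x) = c ^ d * F x"
proof -
  obtain e where "\<And>x. F x = (\<Sum>m | (\<Sum>i\<in>UNIV. m i) = d. e m * (\<Prod>i\<in>UNIV. (x $ i) ^ m i))"
    using assms by (auto simp: form_def)
  then show ?thesis
    by (auto simp: power_mult_distrib prod.distrib sum_distrib_left power_sum[symmetric] mult_ac
        intro!: sum.cong)
qed

lemma form_continuous:
  assumes "form d F"
  shows "continuous_on A F"
proof -
  obtain e where "F = (\<lambda>x. \<Sum>m | (\<Sum>i\<in>UNIV. m i) = d. e m * (\<Prod>i\<in>UNIV. (x $ i) ^ m i))"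
    using assms by (auto simp: form_def)
  then show ?thesis by (simp only:) (intro continuous_intros)
qed

lemma form_holomorphic:
  assumes "form d F" "\<And>i. (\<lambda>z. f z $ i) holomorphic_on A"
  shows "(\<lambda>z. F (f z)) holomorphic_on A"
proof -
  obtain e where "F = (\<lambda>x. \<Sum>m | (\<Sum>i\<in>UNIV. m i) = d. e m * (\<Prod>i\<in>UNIV. (x $ i) ^ m i))"
    using assms by (auto simp: form_def)
  then show ?thesis by (simp only:) (intro holomorphic_intros assms)
qed

text \<open>
  Restriction to complex lines reduces questions on parametrizations to one complex variable.
\<close>

lemma has_field_derivative_along_line:
  fixes \<phi> :: "complex^2 \<Rightarrow> complex^'n"
  assumes D: "(\<phi> has_derivative D) (at (s + z *s w))" "\<And>c v. D (c *s v) = c *s D v"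
  shows "((\<lambda>z. \<phi> (s + z *s w) $ i) has_field_derivative (D w $ i)) (at z)"
proof -
  have "((\<lambda>z. s + z *s w) has_derivative (\<lambda>h. \<chi> i. h * w $ i)) (at z)"
    by (rule has_derivative_vec_of_components) (auto intro!: derivative_eq_intros)
  then have "((\<lambda>z. s + z *s w) has_derivative (\<lambda>h. h *s w)) (at z)"
    by (simp add: vector_scalar_mult_def)
  then have "((\<lambda>z. \<phi> (s + z *s w)) has_derivative (\<lambda>h. D (h *s w))) (at z)"
    using has_derivative_compose D(1) by blast
  then have "((\<lambda>z. \<phi> (s + z *s w) $ i) has_derivative (\<lambda>h. D (h *s w) $ i)) (at z)"
    by (rule bounded_linear.has_derivative[OF bounded_linear_vec_nth])
  then show ?thesis
    by (simp add: has_field_derivative_def D(2) mult_commute_abs)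
qed

lemma local_paramE:
  assumes "local_param X p \<phi>"
  obtains U where "open U" "0 \<in> U" "\<phi> 0 = p" "\<phi> ` U \<subseteq> X"
    "\<And>s. s \<in> U \<Longrightarrow> \<exists>D. (\<phi> has_derivative D) (at s) \<and> (\<forall>c v. D (c *s v) = c *s D v) \<and>
        (\<forall>v. D v \<in> vec.span {\<phi> s} \<longrightarrow> v = 0)"
    "\<And>W. open W \<Longrightarrow> W \<subseteq> U \<Longrightarrow> openin (top_of_set X) {c *s \<phi> s | c s. c \<noteq> 0 \<and> s \<in> W}"
proof -
  obtain U where U: "open U \<and> 0 \<in> U \<and> \<phi> 0 = p \<and> \<phi> ` U \<subseteq> X \<and>
     (\<forall>s\<in>U. \<exists>D. (\<phi> has_derivative D) (at s) \<and> (\<forall>c v. D (c *s v) = c *s D v) \<and>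
                 (\<forall>v. D v \<in> vec.span {\<phi> s} \<longrightarrow> v = 0)) \<and>
     (\<forall>s\<in>U. \<forall>t\<in>U. \<forall>c. \<phi> s = c *s \<phi> t \<longrightarrow> s = t) \<and>
     (\<forall>W. open W \<and> W \<subseteq> U \<longrightarrow>
        openin (top_of_set X) {c *s \<phi> s | c s. c \<noteq> 0 \<and> s \<in> W})"
    using assms unfolding local_param_def by (rule exE)
  show thesis
    by (rule that[of U]) (use U in \<open>simp_all\<close>)
qed

text \<open>
  The identity theorem. The set \<open>V\<close> of points near which \<open>G\<close> vanishes on \<open>X\<close> is open. If a chart at \<open>x\<close>
  meets \<open>V\<close>, then \<open>G\<close> vanishes on the whole chart, by analytic continuation along the complex lines through
  a point of \<open>V\<close>; so \<open>V\<close> is also closed.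
\<close>

lemma form_zero_if_zero_on_open:
  fixes X :: "(complex^'n) set"
  assumes chart: "\<And>p. p \<in> X \<Longrightarrow> \<exists>\<phi>. local_param X p \<phi>"
    and G: "form d G" and X: "connected X"
    and Omega: "open Omega" "X \<inter> Omega \<noteq> {}" "\<And>x. x \<in> X \<inter> Omega \<Longrightarrow> G x = 0"
    and x: "x \<in> X"
  shows "G x = 0"
proof -
  define V where "V = {x \<in> X. \<exists>B. open B \<and> x \<in> B \<and> (\<forall>y\<in>X \<inter> B. G y = 0)}"
  have "openin (top_of_set X) V"
  proof (subst openin_subopen, intro ballI)
    fix x assume "x \<in> V"
    then obtain B where B: "x \<in> X" "open B" "x \<in> B" "\<forall>y\<in>X \<inter> B. G y = 0" by (auto simp: V_def)
    then have "X \<inter> B \<subseteq> V" by (auto simp: V_def)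
    then show "\<exists>T. openin (top_of_set X) T \<and> x \<in> T \<and> T \<subseteq> V"
      using B by (intro exI[of _ "X \<inter> B"]) auto
  qed
  moreover have "closedin (top_of_set X) V"
    unfolding closedin_def
  proof (intro conjI)
    show "V \<subseteq> topspace (top_of_set X)" by (auto simp: V_def)
    show "openin (top_of_set X) (topspace (top_of_set X) - V)"
    proof (subst openin_subopen, intro ballI)
      fix x assume x: "x \<in> topspace (top_of_set X) - V"
      then obtain \<phi> :: "complex^2 \<Rightarrow> complex^'n" and U where \<phi>: "open U" "0 \<in> U" "\<phi> 0 = x" "\<phi> ` U \<subseteq> X"
        "\<And>s. s \<in> U \<Longrightarrow> \<exists>D. (\<phi> has_derivative D) (at s) \<and> (\<forall>c v. D (c *s v) = c *s D v) \<and>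
           (\<forall>v. D v \<in> vec.span {\<phi> s} \<longrightarrow> v = 0)"
        "\<And>W. open W \<Longrightarrow> W \<subseteq> U \<Longrightarrow> openin (top_of_set X) {c *s \<phi> s | c s. c \<noteq> 0 \<and> s \<in> W}"
      proof -
        have "x \<in> X" using x by auto
        then obtain \<phi> where "local_param X x \<phi>" using chart by blast
        then show thesis
          by (rule local_paramE) (rule that)
      qed
      obtain r where r: "r > 0" "ball 0 r \<subseteq> U"
        using \<phi>(1,2) by (metis openE)
      define N where "N = {c *s \<phi> s | c s. c \<noteq> 0 \<and> s \<in> ball 0 r}"
      have opN: "openin (top_of_set X) N" unfolding N_def using r(2) by (intro \<phi>(6)) auto
      have xN: "x \<in> N"
        unfolding N_def using \<phi>(3) r(1) by (intro CollectI exI[of _ 1] exI[of _ 0]) auto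
      have "N \<inter> V = {}"
      proof (rule ccontr)
        assume "N \<inter> V \<noteq> {}"
        then obtain c s where cs: "c \<noteq> 0" "s \<in> ball 0 r" "c *s \<phi> s \<in> V"
          unfolding N_def by blast
        then obtain B where B: "open B" "c *s \<phi> s \<in> B" "\<forall>y\<in>X \<inter> B. G y = 0"
          by (auto simp: V_def)
        have "G (\<phi> t) = 0" if t: "t \<in> ball 0 r" for t
        proof -
          \<comment> \<open>The complex line in the chart through \<open>s\<close>, where \<open>G\<close> vanishes nearby, and \<open>t\<close>.\<close>
          define \<gamma> where "\<gamma> z = s + z *s (t - s)" for z
          define A where "A = \<gamma> -` ball 0 r"
          have \<gamma>_cont: "continuous_on UNIV \<gamma>"
          proof -
            have "\<gamma> = (\<lambda>z. \<chi> i. s $ i + z * (t - s) $ i)"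
              by (simp add: \<gamma>_def fun_eq_iff vec_eq_iff algebra_simps)
            then show ?thesis by (simp only:) (intro continuous_intros)
          qed
          have "open A" unfolding A_def
            using \<gamma>_cont by (intro open_vimage) auto
          have "convex A"
            unfolding convex_def
          proof (intro ballI allI impI)
            fix x y and u v :: real
            assume xy: "x \<in> A" "y \<in> A" and uv: "0 \<le> u" "0 \<le> v" "u + v = 1"
            have v: "complex_of_real v = 1 - of_real u"
              using uv(3) by (metis add_diff_cancel_left' of_real_1 of_real_diff)
            have "\<gamma> (u *\<^sub>R x + v *\<^sub>R y) = u *\<^sub>R \<gamma> x + v *\<^sub>R \<gamma> y"
              by (simp add: \<gamma>_def vec_eq_iff scaleR_conv_of_real[where 'a = complex] v algebra_simps)
            also have "\<dots> \<in> ball 0 r"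
              using xy uv by (intro convexD[OF convex_ball]) (auto simp: A_def)
            finally show "u *\<^sub>R x + v *\<^sub>R y \<in> A" by (simp add: A_def)
          qed
          have hol_i: "(\<lambda>z. \<phi> (\<gamma> z) $ i) holomorphic_on A" for i
          proof (subst holomorphic_on_open[OF \<open>open A\<close>], intro ballI)
            fix z assume "z \<in> A"
            then have "\<gamma> z \<in> U" using r(2) by (auto simp: A_def)
            then obtain D where "(\<phi> has_derivative D) (at (\<gamma> z))" "\<And>c v. D (c *s v) = c *s D v"
              using \<phi>(5) by blast
            then show "\<exists>f'. ((\<lambda>z. \<phi> (\<gamma> z) $ i) has_field_derivative f') (at z)"
              unfolding \<gamma>_def using has_field_derivative_along_line by blast
          qed
          then have hol: "(\<lambda>z. G (\<phi> (\<gamma> z))) holomorphic_on A"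
            by (rule form_holomorphic[OF G])
          have "continuous_on A (\<lambda>z. \<chi> i. c * \<phi> (\<gamma> z) $ i)"
            by (intro continuous_intros holomorphic_on_imp_continuous_on hol_i)
          then have "continuous_on A (\<lambda>z. c *s \<phi> (\<gamma> z))"
            by (simp add: vector_scalar_mult_def)
          then have A0: "open (A \<inter> (\<lambda>z. c *s \<phi> (\<gamma> z)) -` B)"
            using \<open>open A\<close> B(1) by (rule continuous_open_preimage)
          have "0 \<in> A \<inter> (\<lambda>z. c *s \<phi> (\<gamma> z)) -` B"
            using cs B by (auto simp: A_def \<gamma>_def)
          then have A1: "A \<inter> (\<lambda>z. c *s \<phi> (\<gamma> z)) -` B \<noteq> {}" by blast
          have A2: "G (\<phi> (\<gamma> z)) = 0" if z: "z \<in> A \<inter> (\<lambda>z. c *s \<phi> (\<gamma> z)) -` B" for z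
          proof -
            have "c *s \<phi> (\<gamma> z) \<in> N"
              using cs(1) z by (auto simp: A_def N_def)
            then have "c *s \<phi> (\<gamma> z) \<in> X"
              using openin_subset[OF opN] by auto
            then have "G (c *s \<phi> (\<gamma> z)) = 0" using B(3) z by auto
            then show ?thesis using form_homogeneous[OF G] cs(1) by simp
          qed
          have A3: "1 \<in> A" using t by (auto simp: A_def \<gamma>_def)
          have "G (\<phi> (\<gamma> 1)) = 0"
            by (rule analytic_continuation_open[OF A0 \<open>open A\<close> A1 convex_connected[OF \<open>convex A\<close>]
                  Int_lower1 hol holomorphic_on_const A2 A3])
          then show ?thesis by (simp add: \<gamma>_def)
        qed
        then have "G y = 0" if "y \<in> N" for y
          using that form_homogeneous[OF G] by (auto simp: N_def)
        moreover obtain B' where "open B'" "N = X \<inter> B'"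
          using opN by (auto simp: openin_open)
        ultimately have "x \<in> V" using xN by (auto simp: V_def)
        then show False using x by auto
      qed
      then show "\<exists>T. openin (top_of_set X) T \<and> x \<in> T \<and> T \<subseteq> topspace (top_of_set X) - V"
        using opN xN openin_subset[OF opN] by (intro exI[of _ N]) auto
    qed
  qed
  moreover have "V \<noteq> {}" using Omega by (auto simp: V_def)
  ultimately have "V = X"
    using X by (auto simp: connected_clopen)
  then show ?thesis using x by (auto simp: V_def)
qed

section \<open>Irreducibility of the Kummer surface\<close>

lemma continuous_on_csqrt_of_real:
  "continuous_on A (\<lambda>u. csqrt (of_real u))"
proof -
  have "csqrt (of_real u) = of_real (sqrt (max u 0)) + \<i> * of_real (sqrt (max (- u) 0))" for u
    by (cases "u \<ge> 0") (auto simp: csqrt_of_real_nonneg csqrt_of_real_nonpos max_def)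
  then show ?thesis by (simp only:) (intro continuous_intros)
qed

text \<open>
  A continuous square root along a segment, with prescribed initial value, even if the segment passes
  through 0. After division by the initial point \<open>A \<noteq> 0\<close> the segment starts at 1; either it lies on
  the real line, where \<open>csqrt\<close> restricts to a continuous function, or it avoids the branch cut.
\<close>

lemma csqrt_segment:
  assumes "x\<^sup>2 = A"
  obtains r :: "real \<Rightarrow> complex" where "continuous_on {0..1} r" "r 0 = x"
    "\<And>t. t \<in> {0..1} \<Longrightarrow> (r t)\<^sup>2 = (1 - of_real t) * A + of_real t * B"
proof (cases "A = 0")
  case True
  show ?thesis
  proof (rule that[of "\<lambda>t. csqrt B * of_real (sqrt t)"])
    show "continuous_on {0..1} (\<lambda>t. csqrt B * complex_of_real (sqrt t))"
      by (intro continuous_intros)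
    show "(csqrt B * complex_of_real (sqrt t))\<^sup>2 = (1 - of_real t) * A + of_real t * B"
      if "t \<in> {0..1}" for t
      using True that by (simp add: power_mult_distrib flip: of_real_power)
  qed (use True assms in auto)
next
  case False
  define q where "q = B / A"
  define f where "f t = 1 - of_real t + of_real t * q" for t :: real
  have "continuous_on {0..1} (\<lambda>t. csqrt (f t))"
  proof (cases "q \<in> \<real>")
    case True
    then obtain u where "q = of_real u" by (auto elim: Reals_cases)
    then have "f t = of_real (1 - t + t * u)" for t by (simp add: f_def)
    moreover have "continuous_on {0..1} (\<lambda>t. csqrt (of_real (1 - t + t * u)))"
      by (rule continuous_on_compose2[OF continuous_on_csqrt_of_real[of UNIV]])
         (auto intro!: continuous_intros)
    ultimately show ?thesis by simp
  next
    case False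
    have "f t \<notin> \<real>\<^sub>\<le>\<^sub>0" if "t \<in> {0..1}" for t
    proof
      assume *: "f t \<in> \<real>\<^sub>\<le>\<^sub>0"
      then have "Im (f t) = 0" by (simp add: complex_nonpos_Reals_iff)
      then have "t * Im q = 0" by (simp add: f_def)
      moreover have "Im q \<noteq> 0" using False by (simp add: complex_is_Real_iff)
      ultimately have "f t = 1" by (simp add: f_def)
      then show False using * by simp
    qed
    moreover have "continuous_on {0..1} f"
      unfolding f_def by (intro continuous_intros)
    ultimately show ?thesis
      by (intro continuous_on_compose2[OF continuous_on_csqrt, where f = f]) auto
  qed
  then have "continuous_on {0..1} (\<lambda>t. x * csqrt (f t))" by (intro continuous_intros)
  moreover have "x * csqrt (f 0) = x" by (simp add: f_def)
  moreover have "(x * csqrt (f t))\<^sup>2 = (1 - of_real t) * A + of_real t * B" for t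
    using assms False by (simp add: power_mult_distrib f_def q_def algebra_simps)
  ultimately show ?thesis using that by blast
qed

context six_points
begin

text \<open>
  The segment from the squares of the coordinates of \<open>p\<close> to \<open>y\<close> stays in the kernel of the moments, and
  avoids 0 by the independence assumption, so its lift by square roots is a path in the surface.
\<close>

lemma path_lift:
  assumes p: "p \<in> kummer a" and y: "\<And>k. k < 3 \<Longrightarrow> moment k y = 0"
    and indep: "\<not> (\<exists>c. \<forall>i. y i = c * (p $ i)\<^sup>2)"
  obtains q where "q \<in> kummer a" "\<And>i. (q $ i)\<^sup>2 = y i" "path_component (kummer a) p q"
proof -
  have "\<exists>r. continuous_on {0..1} r \<and> r 0 = p $ i \<and>
      (\<forall>t\<in>{0..1}. (r t)\<^sup>2 = (1 - of_real t) * (p $ i)\<^sup>2 + of_real t * y i)" for i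
    using csqrt_segment[OF refl, of "p $ i" "y i"] by metis
  then obtain r where r: "\<And>i. continuous_on {0..1} (r i)" "\<And>i. r i 0 = p $ i"
    "\<And>i t. t \<in> {0..1::real} \<Longrightarrow> (r i t)\<^sup>2 = (1 - of_real t) * (p $ i)\<^sup>2 + of_real t * y i"
    by metis
  define g where "g t = (\<chi> i. r i t)" for t
  have g: "g t \<in> kummer a" if t: "t \<in> {0..1}" for t
  proof -
    have "(\<lambda>i. (g t $ i)\<^sup>2) = (\<lambda>i. (1 - of_real t) * (p $ i)\<^sup>2 + of_real t * y i)"
      using r(3)[OF t] by (simp add: g_def)
    moreover have "g t \<noteq> 0"
    proof
      assume "g t = 0"
      then have *: "(1 - of_real t) * (p $ i)\<^sup>2 + of_real t * y i = 0" for i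
        using r(3)[OF t, of i] by (simp add: g_def vec_eq_iff)
      show False
      proof (cases "t = 0")
        case True
        then have "p = 0" using * by (simp add: vec_eq_iff)
        then show False using p by (simp add: kummer_iff)
      next
        case False
        have "y i = (- (1 - of_real t) / of_real t) * (p $ i)\<^sup>2" for i
          using *[of i] False by (simp add: field_simps eq_neg_iff_add_eq_0)
        then show False using indep by blast
      qed
    qed
    ultimately show ?thesis
      using p y by (simp add: kummer_iff moment_add moment_scale)
  qed
  have "path g"
    unfolding path_def g_def by (intro continuous_intros r)
  moreover have "path_image g \<subseteq> kummer a" using g by (auto simp: path_image_def)
  moreover have "pathstart g = p" by (simp add: pathstart_def g_def r vec_eq_iff)
  ultimately have "path_component (kummer a) p (g 1)"
    unfolding path_component_def by (auto simp: pathfinish_def)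
  moreover have "(g 1 $ i)\<^sup>2 = y i" for i using r(3)[of 1 i] by (simp add: g_def)
  moreover have "g 1 \<in> kummer a" using g by simp
  ultimately show ?thesis using that by blast
qed

lemma kernel_vector_vanishing_at:
  obtains y where "\<And>k. k < 3 \<Longrightarrow> moment k y = 0" "y j = 0" "y \<noteq> (\<lambda>i. 0)"
proof -
  have "2 \<le> card (UNIV - {j})" by simp
  then obtain S where "S \<subseteq> UNIV - {j}" "card S = 2"
    by (rule obtain_subset_with_card_n)
  then obtain m n where "m \<noteq> n" "j \<noteq> m" "j \<noteq> n" by (auto simp: card_2_iff)
  from kernel_vector[OF this(2,3,1)] obtain y where
    "\<And>k. k < 3 \<Longrightarrow> moment k y = 0" "y m = 1" "y n = 0" "y j = 0" by blast
  then show ?thesis using that[of y] by (metis zero_neq_one)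
qed

definition negate :: "6 \<Rightarrow> complex^6 \<Rightarrow> complex^6" where
  "negate j x = (\<chi> i. if i = j then - x $ i else x $ i)"

lemma negate_kummer: "x \<in> kummer a \<Longrightarrow> negate j x \<in> kummer a"
proof -
  assume x: "x \<in> kummer a"
  have "(\<lambda>i. (negate j x $ i)\<^sup>2) = (\<lambda>i. (x $ i)\<^sup>2)" by (auto simp: negate_def)
  moreover have "negate j x \<noteq> 0"
    using x by (auto simp: negate_def vec_eq_iff kummer_iff)
  ultimately show ?thesis using x by (simp add: kummer_iff)
qed

text \<open>
  A path from \<open>p\<close> to a point \<open>q\<close> with vanishing coordinate \<open>j\<close>, followed by the reflection of that path
  traversed backwards; the two fit together because the reflection fixes \<open>q\<close>.
\<close>

lemma path_component_negate:
  assumes p: "p \<in> kummer a"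
  shows "path_component (kummer a) p (negate j p)"
proof (cases "p $ j = 0")
  case True
  then have "negate j p = p" by (auto simp: negate_def vec_eq_iff)
  then show ?thesis using p path_component_refl by simp
next
  case False
  obtain y where y: "\<And>k. k < 3 \<Longrightarrow> moment k y = 0" "y j = 0" "y \<noteq> (\<lambda>i. 0)"
    using kernel_vector_vanishing_at[of j] by metis
  have "\<not> (\<exists>c. \<forall>i. y i = c * (p $ i)\<^sup>2)"
  proof
    assume "\<exists>c. \<forall>i. y i = c * (p $ i)\<^sup>2"
    then obtain c where c: "\<And>i. y i = c * (p $ i)\<^sup>2" by auto
    then have "c = 0" using y(2) False by (metis mult_eq_0_iff power_not_zero)
    then show False using c y(3) by auto
  qed
  then obtain q where q: "q \<in> kummer a" "\<And>i. (q $ i)\<^sup>2 = y i" "path_component (kummer a) p q"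
    using path_lift[OF p y(1)] by metis
  have "q $ j = 0" using q(2)[of j] y(2) by simp
  then have nq: "negate j q = q" by (auto simp: negate_def vec_eq_iff)
  obtain g where g: "path g" "path_image g \<subseteq> kummer a" "pathstart g = p" "pathfinish g = q"
    using q(3) unfolding path_component_def by blast
  have "continuous_on A (negate j)" for A
    unfolding negate_def
  proof (intro continuous_on_vec_lambda)
    show "continuous_on A (\<lambda>x :: complex^6. if i = j then - x $ i else x $ i)" for i
      by (cases "i = j") (auto intro!: continuous_intros)
  qed
  then have "path (negate j \<circ> g)" by (intro path_continuous_image g)
  moreover have "path_image (negate j \<circ> g) \<subseteq> kummer a"
    using g(2) negate_kummer by (auto simp: path_image_compose)
  ultimately have "path_component (kummer a) (negate j p) q"
    unfolding path_component_def using g(3,4) nq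
    by (intro exI[of _ "negate j \<circ> g"]) (simp add: pathstart_compose pathfinish_compose)
  then show ?thesis using q(3) path_component_trans path_component_sym by blast
qed

lemma path_component_same_squares:
  assumes "p \<in> kummer a" "q \<in> kummer a" "\<And>i. (q $ i)\<^sup>2 = (p $ i)\<^sup>2"
  shows "path_component (kummer a) p q"
proof -
  have "path_component (kummer a) p q"
    if "finite A" "p \<in> kummer a" "\<And>i. (q $ i)\<^sup>2 = (p $ i)\<^sup>2" "\<And>i. i \<notin> A \<Longrightarrow> q $ i = p $ i"
    for p A
    using that
  proof (induction A arbitrary: p rule: finite_induct)
    case empty
    then have "q = p" by (simp add: vec_eq_iff)
    then show ?case using empty path_component_refl by simp
  next
    case (insert j A)
    define p' where "p' = (if q $ j = p $ j then p else negate j p)"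
    have "path_component (kummer a) p p'"
      using insert.prems(1) path_component_negate by (auto simp: p'_def intro: path_component_refl)
    moreover have "path_component (kummer a) p' q"
    proof (rule insert.IH)
      show "p' \<in> kummer a" using insert.prems(1) negate_kummer by (simp add: p'_def)
      show "(q $ i)\<^sup>2 = (p' $ i)\<^sup>2" for i
        using insert.prems(2)[of i] by (simp add: p'_def negate_def)
      show "q $ i = p' $ i" if "i \<notin> A" for i
        using insert.prems(2)[of i] insert.prems(3)[of i] that
        by (auto simp: p'_def negate_def power2_eq_iff)
    qed
    ultimately show ?case by (rule path_component_trans)
  qed
  from this[of UNIV p] assms show ?thesis by simp
qed

text \<open>
  If the squares of \<open>p\<close> and \<open>q\<close> are proportional, the segment joining them may pass through 0; in this
  case a third point is used, whose squares are not proportional to these.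
\<close>

lemma connected_kummer: "connected (kummer a)"
proof -
  have indep: "path_component (kummer a) p q"
    if pq: "p \<in> kummer a" "q \<in> kummer a" "\<not> (\<exists>c. \<forall>i. (q $ i)\<^sup>2 = c * (p $ i)\<^sup>2)" for p q
  proof -
    have "moment k (\<lambda>i. (q $ i)\<^sup>2) = 0" if "k < 3" for k
      using pq(2) that by (simp add: kummer_iff)
    from path_lift[OF pq(1) this pq(3)] obtain q' where q': "q' \<in> kummer a"
      "\<And>i. (q' $ i)\<^sup>2 = (q $ i)\<^sup>2" "path_component (kummer a) p q'" by metis
    have "path_component (kummer a) q' q"
      using path_component_same_squares[OF q'(1) pq(2)] q'(2) by simp
    with q'(3) show ?thesis by (rule path_component_trans)
  qed
  have "path_component (kummer a) p q" if pq: "p \<in> kummer a" "q \<in> kummer a" for p q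
  proof (cases "\<exists>c. \<forall>i. (q $ i)\<^sup>2 = c * (p $ i)\<^sup>2")
    case True
    then obtain c where c: "\<And>i. (q $ i)\<^sup>2 = c * (p $ i)\<^sup>2" by auto
    obtain j where j: "q $ j \<noteq> 0" using pq(2) by (auto simp: kummer_iff vec_eq_iff)
    then have pj: "p $ j \<noteq> 0" using c[of j] by auto
    obtain y where y: "\<And>k. k < 3 \<Longrightarrow> moment k y = 0" "y j = 0" "y \<noteq> (\<lambda>i. 0)"
      using kernel_vector_vanishing_at[of j] by metis
    have "\<not> (\<exists>c. \<forall>i. y i = c * (p $ i)\<^sup>2)"
    proof
      assume "\<exists>c. \<forall>i. y i = c * (p $ i)\<^sup>2"
      then obtain d where d: "\<And>i. y i = d * (p $ i)\<^sup>2" by auto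
      then have "d = 0" using y(2) pj by (metis mult_eq_0_iff power_not_zero)
      then show False using d y(3) by auto
    qed
    then obtain r where r: "r \<in> kummer a" "\<And>i. (r $ i)\<^sup>2 = y i" "path_component (kummer a) p r"
      using path_lift[OF pq(1) y(1)] by metis
    have "\<not> (\<exists>c. \<forall>i. (q $ i)\<^sup>2 = c * (r $ i)\<^sup>2)"
      using j y(2) r(2)[of j] by (metis mult_zero_right power_not_zero)
    then have "path_component (kummer a) r q" using indep r(1) pq(2) by blast
    then show ?thesis using r(3) path_component_trans by blast
  qed (use indep pq in blast)
  then show ?thesis
    by (intro path_connected_imp_connected) (auto simp: path_connected_component)
qed

lemma kummer_point:
  assumes "degree R \<le> 2" "R \<noteq> 0"
  shows "(\<chi> i. csqrt (weight i * poly R (a i))) \<in> kummer a" (is "?x \<in> _")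
proof -
  have "?x \<noteq> 0"
  proof
    assume "?x = 0"
    then have "poly R (a i) = 0" for i using weight_nonzero by (simp add: vec_eq_iff)
    then have "range a \<subseteq> {t. poly R t = 0}" by auto
    then have "card (range a) \<le> degree R"
      using card_poly_roots_bound[OF assms(2)] card_mono[OF poly_roots_finite[OF assms(2)]]
      by (meson order_trans)
    then show False using assms(1) inj_a by (simp add: card_image)
  qed
  then show ?thesis using moment_poly_eq_0[OF assms(1)] by (simp add: kummer_iff)
qed

lemma form_quadric: "form 2 (quadric a k)"
proof -
  have "form 2 (\<lambda>x :: complex^6. \<Sum>i\<in>UNIV. a i ^ k * (x $ i)\<^sup>2)"
    using form_power[OF form_coordinate, where n = 2] by (intro form_sum form_scale) simp
  then show ?thesis by (simp add: quadric_def[abs_def])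
qed

lemma zariski_closed_kummer: "zariski_closed (kummer a)"
  unfolding zariski_closed_def
  by (intro exI[of _ "{quadric a 0, quadric a 1, quadric a 2}"])
     (use form_quadric in \<open>auto simp: kummer_def\<close>)

text \<open>
  If two forms \<open>F\<close>, \<open>G\<close> have a product vanishing on the surface and \<open>F\<close> does not vanish at \<open>p\<close>, then \<open>G\<close>
  vanishes near \<open>p\<close>, hence everywhere.
\<close>

lemma projective_variety_kummer: "projective_variety (kummer a)"
  unfolding projective_variety_def
proof (intro conjI allI impI zariski_closed_kummer)
  show "kummer a \<noteq> {}" using kummer_point[of 1] by auto
  fix Y Z assume YZ: "zariski_closed Y \<and> zariski_closed Z \<and> kummer a \<subseteq> Y \<union> Z"
  show "kummer a \<subseteq> Y \<or> kummer a \<subseteq> Z"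
  proof (rule ccontr)
    assume "\<not> (kummer a \<subseteq> Y \<or> kummer a \<subseteq> Z)"
    then obtain p q where p: "p \<in> kummer a" "p \<notin> Y" and q: "q \<in> kummer a" "q \<notin> Z" by blast
    obtain S where S: "\<forall>F\<in>S. \<exists>d. form d F" "Y = {x. x \<noteq> 0 \<and> (\<forall>F\<in>S. F x = 0)}"
      using YZ by (auto simp: zariski_closed_def)
    obtain S' where S': "\<forall>F\<in>S'. \<exists>d. form d F" "Z = {x. x \<noteq> 0 \<and> (\<forall>F\<in>S'. F x = 0)}"
      using YZ by (auto simp: zariski_closed_def)
    obtain F d where F: "F \<in> S" "form d F" "F p \<noteq> 0"
      using p S by (auto simp: kummer_iff)
    obtain G e where G: "G \<in> S'" "form e G" "G q \<noteq> 0"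
      using q S' by (auto simp: kummer_iff)
    have "open {x. F x \<noteq> 0}"
      by (intro open_Collect_neq form_continuous[OF F(2)] continuous_on_const)
    moreover have "kummer a \<inter> {x. F x \<noteq> 0} \<noteq> {}" using p F(3) by auto
    moreover have "G x = 0" if "x \<in> kummer a \<inter> {x. F x \<noteq> 0}" for x
      using that YZ S(2) S'(2) F(1) G(1) by blast
    ultimately have "G q = 0"
      using form_zero_if_zero_on_open[of "kummer a" e G "{x. F x \<noteq> 0}" q]
        local_param_exists G(2) connected_kummer q(1) by metis
    then show False using G(3) by simp
  qed
qed

end

section \<open>The net of quadrics on a tangent plane\<close>

lemma quadratic_of_roots:
  fixes R :: "complex poly"
  assumes "degree R \<le> 2" "poly R e1 = 0" "poly R e2 = 0" "e1 \<noteq> e2"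
  shows "R = smult (coeff R 2) ([:- e1, 1:] * [:- e2, 1:])"
proof (rule poly_eqI_degree_lead_coeff[where n = 2 and A = "{e1, e2}"])
  show "coeff R 2 = coeff (smult (coeff R 2) ([:- e1, 1:] * [:- e2, 1:])) 2"
    by (simp add: numeral_2_eq_2)
  show "degree (smult (coeff R 2) ([:- e1, 1:] * [:- e2, 1:])) \<le> 2"
    by (intro order_trans[OF degree_smult_le]) simp
qed (use assms in \<open>auto simp: algebra_simps\<close>)

lemma linear_interpolation:
  fixes e1 e2 :: complex
  assumes "e1 \<noteq> e2"
  obtains S where "degree S \<le> 1" "poly S e1 = x1" "poly S e2 = x2"
proof (rule that[of "smult (x1 / (e1 - e2)) [:- e2, 1:] + smult (x2 / (e2 - e1)) [:- e1, 1:]"])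
  show "degree (smult (x1 / (e1 - e2)) [:- e2, 1:] + smult (x2 / (e2 - e1)) [:- e1, 1:]) \<le> 1"
    by (intro degree_add_le order_trans[OF degree_smult_le]) auto
  have "e1 - e2 \<noteq> 0" "e2 - e1 \<noteq> 0" using assms by auto
  then show "poly (smult (x1 / (e1 - e2)) [:- e2, 1:] + smult (x2 / (e2 - e1)) [:- e1, 1:]) e1 = x1"
    "poly (smult (x1 / (e1 - e2)) [:- e2, 1:] + smult (x2 / (e2 - e1)) [:- e1, 1:]) e2 = x2"
    by (simp_all add: divide_simps) (simp_all add: algebra_simps)
qed

context six_points
begin

lemma interp_add: "interp (\<lambda>i. y i + z i) = interp y + interp z"
  by (simp add: interp_def Let_def moment_add algebra_simps)

lemma interp_scale: "interp (\<lambda>i. c * z i) = smult c (interp z)"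
  by (simp add: interp_def Let_def moment_scale algebra_simps)

lemma sum_poly_moments:
  assumes "degree S \<le> 2" "\<And>k. k < 3 \<Longrightarrow> moment k z = 0"
  shows "(\<Sum>i\<in>UNIV. poly S (a i) * z i) = 0"
proof -
  obtain c0 c1 c2 where S: "S = [:c0, c1, c2:]" using degree_le_2_eq[OF assms(1)] by blast
  have "(\<Sum>i\<in>UNIV. poly S (a i) * z i) = c0 * moment 0 z + c1 * moment 1 z + c2 * moment 2 z"
    by (simp add: S moment_def sum_distrib_left sum.distrib[symmetric] power2_eq_square algebra_simps)
  then show ?thesis using assms(2) by simp
qed

text \<open>
  The quadrics of the net, parametrized by polynomials \<open>S\<close> of degree at most 2.
\<close>

definition net_quadric :: "complex poly \<Rightarrow> complex^6 \<Rightarrow> complex" where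
  "net_quadric S x = (\<Sum>i\<in>UNIV. poly S (a i) * (x $ i)\<^sup>2)"

lemma net_quadric_eq:
  "net_quadric [:c0, c1, c2:] x = c0 * quadric a 0 x + c1 * quadric a 1 x + c2 * quadric a 2 x"
  by (simp add: net_quadric_def quadric_def sum_distrib_left sum.distrib[symmetric]
      power2_eq_square algebra_simps)

lemma kummer_net_eq: "kummer_net a = {net_quadric S | S. degree S \<le> 2}"
proof (intro equalityI subsetI)
  fix Q assume "Q \<in> kummer_net a"
  then obtain c0 where "Q - (\<lambda>x. c0 * quadric a 0 x) \<in> cfun.span {quadric a 1, quadric a 2}"
    unfolding kummer_net_def cfun.span_breakdown_eq by blast
  then obtain c1 where "Q - (\<lambda>x. c0 * quadric a 0 x) - (\<lambda>x. c1 * quadric a 1 x) \<in> cfun.span {quadric a 2}"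
    unfolding cfun.span_breakdown_eq by blast
  then obtain c2 where "Q - (\<lambda>x. c0 * quadric a 0 x) - (\<lambda>x. c1 * quadric a 1 x) = (\<lambda>x. c2 * quadric a 2 x)"
    unfolding cfun.span_singleton by blast
  then have "Q x = net_quadric [:c0, c1, c2:] x" for x
    unfolding net_quadric_eq by (auto simp: fun_eq_iff algebra_simps)
  then have "Q = net_quadric [:c0, c1, c2:]" by blast
  then show "Q \<in> {net_quadric S | S. degree S \<le> 2}" by force
next
  fix Q assume "Q \<in> {net_quadric S | S. degree S \<le> 2}"
  then obtain S where "Q = net_quadric S" "degree S \<le> 2" by blast
  then obtain c0 c1 c2 where "Q = net_quadric [:c0, c1, c2:]" using degree_le_2_eq by metis
  then have Q: "Q = (\<lambda>x. c0 * quadric a 0 x) + (\<lambda>x. c1 * quadric a 1 x) + (\<lambda>x. c2 * quadric a 2 x)"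
    by (auto simp: fun_eq_iff net_quadric_eq)
  show "Q \<in> kummer_net a"
    unfolding Q kummer_net_def
    by (intro cfun.span_add cfun.span_scale cfun.span_base) auto
qed

end

text \<open>
  The polynomial with the roots \<open>e1\<close>, \<open>e2\<close> is the one attached to the squares of the coordinates of \<open>p\<close>.
\<close>

locale kummer_general_point = six_points +
  fixes p :: "complex^6" and e1 e2 c :: complex
  assumes p_in_X: "p \<in> kummer a" and p_nonzero: "p $ i \<noteq> 0"
    and roots: "interp (\<lambda>i. (p $ i)\<^sup>2) = smult c ([:- e1, 1:] * [:- e2, 1:])"
    and e_neq: "e1 \<noteq> e2" and c_neq: "c \<noteq> 0"
begin

lemma p_square: "(p $ i)\<^sup>2 = weight i * (c * (a i - e1) * (a i - e2))"
  using interp_correct[of "\<lambda>i. (p $ i)\<^sup>2" i] p_in_X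
  by (simp add: kummer_iff roots algebra_simps)

lemma e_not_node: "e1 \<notin> range a" "e2 \<notin> range a"
proof -
  have "a i \<noteq> e1 \<and> a i \<noteq> e2" for i
    using p_square[of i] p_nonzero[of i] by auto
  then show "e1 \<notin> range a" "e2 \<notin> range a" by auto
qed

text \<open>
  The kernel of the differentials at \<open>p\<close> of the three quadrics.
\<close>

definition plane :: "(complex^6) set" where
  "plane = {v. \<forall>k<3. moment k (\<lambda>i. p $ i * v $ i) = 0}"

text \<open>
  The polynomial \<open>R\<close> with \<open>p i * v i = weight i * R (a i)\<close> for \<open>v\<close> in \<open>plane\<close>. As it is defined and linear on
  the whole space, evaluating it gives linear forms.
\<close>

definition tangent_poly :: "complex^6 \<Rightarrow> complex poly" where
  "tangent_poly v = interp (\<lambda>i. p $ i * v $ i)"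

definition tangent_vector :: "complex poly \<Rightarrow> complex^6" where
  "tangent_vector R = (\<chi> i. weight i * poly R (a i) / p $ i)"

lemma tangent_poly_degree: "degree (tangent_poly v) \<le> 2"
  by (simp add: tangent_poly_def degree_interp)

lemma tangent_poly_add: "tangent_poly (u + v) = tangent_poly u + tangent_poly v"
  by (simp add: tangent_poly_def distrib_left interp_add)

lemma tangent_poly_scale: "tangent_poly (d *s v) = smult d (tangent_poly v)"
  by (simp add: tangent_poly_def interp_scale mult.left_commute)

lemma tangent_poly_p: "tangent_poly p = smult c ([:- e1, 1:] * [:- e2, 1:])"
  by (simp add: tangent_poly_def roots flip: power2_eq_square)

lemma p_mult_tangent_vector: "(\<lambda>i. p $ i * tangent_vector R $ i) = (\<lambda>i. weight i * poly R (a i))"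
  by (simp add: tangent_vector_def p_nonzero)

lemma tangent_vector_in_plane: "degree R \<le> 2 \<Longrightarrow> tangent_vector R \<in> plane"
  by (simp add: plane_def p_mult_tangent_vector moment_poly_eq_0)

lemma tangent_poly_tangent_vector: "degree R \<le> 2 \<Longrightarrow> tangent_poly (tangent_vector R) = R"
  unfolding tangent_poly_def p_mult_tangent_vector by (rule interp_poly)

lemma plane_component:
  assumes "v \<in> plane"
  shows "p $ i * v $ i = weight i * poly (tangent_poly v) (a i)"
  unfolding tangent_poly_def using assms by (intro interp_correct) (simp add: plane_def)

lemma plane_subspace: "vec.subspace plane"
proof -
  have "(\<lambda>i. p $ i * (d *s x) $ i) = (\<lambda>i. d * (p $ i * x $ i))" for d x
    by (simp add: mult.left_commute)
  moreover have "moment k (\<lambda>i. 0) = 0" for k by (simp add: moment_def)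
  ultimately show ?thesis
    by (simp add: vec.subspace_def plane_def distrib_left moment_add moment_scale)
qed

lemma p_in_plane: "p \<in> plane"
  using p_in_X by (simp add: plane_def kummer_iff flip: power2_eq_square)

text \<open>
  A polynomial of degree at most 2 with the roots \<open>e1\<close> and \<open>e2\<close> is a multiple of the polynomial of \<open>p\<close>.
\<close>

lemma plane_kernel:
  assumes "v \<in> plane" "poly (tangent_poly v) e1 = 0" "poly (tangent_poly v) e2 = 0"
  shows "v \<in> vec.span {p}"
proof -
  have R: "tangent_poly v = smult (coeff (tangent_poly v) 2) ([:- e1, 1:] * [:- e2, 1:])"
    using assms e_neq by (intro quadratic_of_roots tangent_poly_degree)
  define d where "d = coeff (tangent_poly v) 2 / c"
  have "v $ i = d * p $ i" for i
  proof -
    have "p $ i * v $ i = weight i * (coeff (tangent_poly v) 2 * (a i - e1) * (a i - e2))"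
      unfolding plane_component[OF assms(1)] by (subst R) (simp add: algebra_simps)
    also have "\<dots> = d * (p $ i)\<^sup>2" using c_neq by (simp add: d_def p_square)
    finally show ?thesis using p_nonzero[of i] by (simp add: power2_eq_square)
  qed
  then have "v = d *s p" by (simp add: vec_eq_iff)
  then show ?thesis by (auto simp: vec.span_singleton)
qed

definition r1 where "r1 v = poly (tangent_poly v) e1"
definition r2 where "r2 v = poly (tangent_poly v) e2"

definition v1 where "v1 = tangent_vector (smult (1 / (e1 - e2)) [:- e2, 1:])"
definition v2 where "v2 = tangent_vector (smult (1 / (e2 - e1)) [:- e1, 1:])"

sublocale pencil_in_plane plane p r1 r2 v1 v2
proof
  have [simp]: "degree (smult (1 / (e1 - e2)) [:- e2, 1:]) \<le> 2"
    "degree (smult (1 / (e2 - e1)) [:- e1, 1:]) \<le> 2" by auto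
  show "v1 \<in> plane" "v2 \<in> plane" unfolding v1_def v2_def by (intro tangent_vector_in_plane; simp)+
  show "p \<noteq> 0" using p_in_X by (simp add: kummer_iff)
  show "r1 v1 = 1" "r2 v1 = 0" "r1 v2 = 0" "r2 v2 = 1"
    unfolding r1_def r2_def v1_def v2_def using e_neq by (simp_all add: tangent_poly_tangent_vector divide_simps)
  show "v \<in> vec.span {p}" if "v \<in> plane" "r1 v = 0" "r2 v = 0" for v
    using that unfolding r1_def r2_def by (rule plane_kernel)
qed (simp_all add: plane_subspace p_in_plane r1_def r2_def tangent_poly_add tangent_poly_scale tangent_poly_p
    algebra_simps)

text \<open>
  For \<open>R = tangent_poly v\<close> and \<open>P = tangent_poly p\<close> the summands of \<open>net_quadric S v\<close> are
  \<open>weight i * S (a i) * (R (a i))\<^sup>2 / P (a i)\<close>, and \<open>S R\<^sup>2\<close> has degree at most 6, so \<open>two_pole_sum\<close>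
  expresses the sum through the roots of \<open>P\<close>.
\<close>

lemma net_quadric_on_plane:
  obtains g1 g2 where "g1 \<noteq> 0" "g2 \<noteq> 0"
    "\<And>S v. degree S \<le> 2 \<Longrightarrow> v \<in> plane \<Longrightarrow>
       net_quadric S v = g1 * poly S e1 * (r1 v)\<^sup>2 + g2 * poly S e2 * (r2 v)\<^sup>2"
proof -
  obtain g1 g2 where g: "g1 \<noteq> 0" "g2 \<noteq> 0"
    "\<And>F. degree F \<le> 6 \<Longrightarrow>
       (\<Sum>i\<in>UNIV. weight i * poly F (a i) / (c * (a i - e1) * (a i - e2)))
       = g1 * poly F e1 + g2 * poly F e2"
    by (rule two_pole_sum[OF e_neq e_not_node c_neq]) (rule that)
  have "net_quadric S v = g1 * poly S e1 * (r1 v)\<^sup>2 + g2 * poly S e2 * (r2 v)\<^sup>2"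
    if S: "degree S \<le> 2" and v: "v \<in> plane" for S v
  proof -
    let ?F = "S * (tangent_poly v)\<^sup>2"
    have "degree ((tangent_poly v)\<^sup>2) \<le> 4"
      using degree_power_le[of "tangent_poly v" 2] tangent_poly_degree[of v] by linarith
    then have F: "degree ?F \<le> 6"
      using degree_mult_le[of S "(tangent_poly v)\<^sup>2"] S by linarith
    have "poly S (a i) * (v $ i)\<^sup>2 = weight i * poly ?F (a i) / (c * (a i - e1) * (a i - e2))" for i
    proof -
      have "(p $ i)\<^sup>2 * (v $ i)\<^sup>2 = (weight i * poly (tangent_poly v) (a i))\<^sup>2"
        using plane_component[OF v, of i] by (simp flip: power_mult_distrib)
      then have "(c * (a i - e1) * (a i - e2)) * (v $ i)\<^sup>2 = weight i * (poly (tangent_poly v) (a i))\<^sup>2"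
        using weight_nonzero[of i] unfolding p_square
        by (simp add: power2_eq_square mult_ac)
      moreover have "c * (a i - e1) * (a i - e2) \<noteq> 0"
        using p_square[of i] p_nonzero[of i] by auto
      ultimately have "(v $ i)\<^sup>2 = weight i * (poly (tangent_poly v) (a i))\<^sup>2 / (c * (a i - e1) * (a i - e2))"
        by (simp only: eq_divide_eq) (simp add: mult.commute)
      then show ?thesis by (simp add: mult_ac)
    qed
    then show ?thesis
      using g(3)[OF F] by (simp add: net_quadric_def r1_def r2_def mult.assoc)
  qed
  then show thesis by (rule that[OF g(1,2)])
qed

text \<open>
  A vector \<open>v\<close> of such a line is tangent and all quadrics of the net vanish at it, in particular those
  that restrict on the plane to nonzero multiples of \<open>r1\<^sup>2\<close> and of \<open>r2\<^sup>2\<close> given by \<open>S = t - e2\<close> and \<open>S = t - e1\<close>.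
\<close>

lemma no_line_through_p:
  assumes L: "vec.subspace L" "vec.dim L = 2" "p \<in> L" "L - {0} \<subseteq> kummer a"
  shows False
proof -
  obtain v where v: "v \<in> L" "v \<notin> vec.span {p}"
    using L(2) by (rule plane_not_in_line)
  have "p + v \<in> L" using L v by (simp add: vec.subspace_add)
  moreover have "p + v \<noteq> 0"
  proof
    assume "p + v = 0"
    then have "v = (- 1) *s p" by (simp add: add_eq_0_iff vec_eq_iff)
    moreover have "(- 1) *s p \<in> vec.span {p}" by (intro vec.span_scale vec.span_base) simp
    ultimately show False using v(2) by simp
  qed
  moreover have "v \<noteq> 0" using v(2) vec.span_zero by metis
  ultimately have X: "p + v \<in> kummer a" "v \<in> kummer a" using L(4) v by auto
  have "v \<in> plane"
    unfolding plane_def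
  proof (intro CollectI allI impI)
    fix k :: nat assume k: "k < 3"
    have "moment k (\<lambda>i. ((p + v) $ i)\<^sup>2)
        = moment k (\<lambda>i. (p $ i)\<^sup>2) + moment k (\<lambda>i. (v $ i)\<^sup>2) + 2 * moment k (\<lambda>i. p $ i * v $ i)"
      unfolding moment_scale[symmetric] moment_add[symmetric]
      by (simp add: power2_sum mult.assoc)
    then show "moment k (\<lambda>i. p $ i * v $ i) = 0"
      using X p_in_X k by (simp add: kummer_iff)
  qed
  moreover have Q: "net_quadric S v = 0" if "degree S \<le> 2" for S
    unfolding net_quadric_def using X(2) that by (intro sum_poly_moments) (auto simp: kummer_iff)
  obtain g1 g2 where g: "g1 \<noteq> 0" "g2 \<noteq> 0" 
    "\<And>S v. degree S \<le> 2 \<Longrightarrow> v \<in> plane \<Longrightarrow>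
       net_quadric S v = g1 * poly S e1 * (r1 v)\<^sup>2 + g2 * poly S e2 * (r2 v)\<^sup>2"
    by (rule net_quadric_on_plane) (rule that)
  have "r1 v = 0" "r2 v = 0"
    using g(3)[of "[:- e2, 1:]" v] g(3)[of "[:- e1, 1:]" v] Q[of "[:- e2, 1:]"] Q[of "[:- e1, 1:]"]
      \<open>v \<in> plane\<close> g(1,2) e_neq by simp_all
  ultimately show False using kernel v(2) by blast
qed

end

section \<open>The second fundamental form\<close>

lemma derivative_of_zero:
  assumes "open A" "z \<in> A" "\<And>y. y \<in> A \<Longrightarrow> f y = 0" "(f has_field_derivative d) (at z)"
  shows "d = 0"
proof -
  have "((\<lambda>_. 0) has_field_derivative d) (at z)"
    using assms(4,1,2) by (rule has_field_derivative_transform_within_open) (use assms(3) in simp)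
  then show ?thesis by (simp add: DERIV_unique[OF _ DERIV_const])
qed

text \<open>
  First and second derivatives of a diagonal quadratic equation along the complex line through 0 in
  the direction \<open>w\<close>. The second derivative exists since a complex differentiable function of one
  variable is twice differentiable.
\<close>

lemma chart_second_order:
  fixes \<phi> :: "complex^2 \<Rightarrow> complex^'n" and b :: "'n \<Rightarrow> complex"
  assumes U: "open U" "0 \<in> U"
    and D: "\<And>s. s \<in> U \<Longrightarrow> (\<phi> has_derivative D s) (at s)" "\<And>s c v. s \<in> U \<Longrightarrow> D s (c *s v) = c *s D s v"
  shows "ddir \<phi> w 0 = D 0 w"
    and "(\<And>s. s \<in> U \<Longrightarrow> (\<Sum>i\<in>UNIV. b i * (\<phi> s $ i)\<^sup>2) = 0) \<Longrightarrow>
      (\<Sum>i\<in>UNIV. b i * (\<phi> 0 $ i * D 0 w $ i)) = 0"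
    and "(\<And>s. s \<in> U \<Longrightarrow> (\<Sum>i\<in>UNIV. b i * (\<phi> s $ i)\<^sup>2) = 0) \<Longrightarrow>
      (\<Sum>i\<in>UNIV. b i * ((D 0 w $ i)\<^sup>2 + \<phi> 0 $ i * ddir (ddir \<phi> w) w 0 $ i)) = 0"
proof -
  define g where "g i z = \<phi> (z *s w) $ i" for i z
  define A where "A = (\<lambda>z. z *s w) -` U"
  have "continuous_on UNIV (\<lambda>z. z *s w)"
    unfolding vector_scalar_mult_def by (intro continuous_intros)
  then have A: "open A" unfolding A_def using U(1) by (intro open_vimage)
  have A0: "0 \<in> A" using U(2) by (simp add: A_def)
  have ddir: "ddir \<phi> w s = D s w" if "s \<in> U" for s
  proof -
    have "deriv (\<lambda>z. \<phi> (s + z *s w) $ i) 0 = D s w $ i" for i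
      by (rule DERIV_imp_deriv, rule has_field_derivative_along_line) (use D that in simp_all)
    then show ?thesis by (simp add: ddir_def vec_eq_iff)
  qed
  show "ddir \<phi> w 0 = D 0 w" using ddir U(2) .
  have g': "(g i has_field_derivative D (z *s w) w $ i) (at z)" if "z \<in> A" for i z
  proof -
    have "((\<lambda>z. \<phi> (0 + z *s w) $ i) has_field_derivative D (z *s w) w $ i) (at z)"
      by (rule has_field_derivative_along_line) (use D that in \<open>simp_all add: A_def\<close>)
    then show ?thesis by (simp add: g_def[abs_def])
  qed
  then have hol: "g i holomorphic_on A" for i
    using A by (auto simp: holomorphic_on_open)
  have dg: "deriv (g i) z = D (z *s w) w $ i" if "z \<in> A" for i z
    using g'[OF that] by (rule DERIV_imp_deriv)
  have g'': "(deriv (g i) has_field_derivative deriv (deriv (g i)) z) (at z)" if "z \<in> A" for i z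
    using holomorphic_derivI[OF holomorphic_deriv[OF hol A] A that] .
  have "deriv (\<lambda>z. ddir \<phi> w (0 + z *s w) $ i) 0 = deriv (deriv (g i)) 0" for i
  proof (rule deriv_cong_ev)
    show "\<forall>\<^sub>F z in nhds 0. ddir \<phi> w (0 + z *s w) $ i = deriv (g i) z"
      using eventually_nhds_in_open[OF A A0]
      by eventually_elim (use ddir dg in \<open>simp add: A_def\<close>)
  qed simp
  then have dd: "ddir (ddir \<phi> w) w 0 $ i = deriv (deriv (g i)) 0" for i
    by (simp add: ddir_def[of "ddir \<phi> w"])
  have gd: "(g i has_field_derivative deriv (g i) z) (at z)" if "z \<in> A" for i z
    using g'[OF that] dg[OF that] by simp
  assume zero: "\<And>s. s \<in> U \<Longrightarrow> (\<Sum>i\<in>UNIV. b i * (\<phi> s $ i)\<^sup>2) = 0"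
  have first: "(\<Sum>i\<in>UNIV. b i * (g i z * deriv (g i) z)) = 0" if z: "z \<in> A" for z
  proof -
    have 1: "((\<lambda>z. \<Sum>i\<in>UNIV. b i * (g i z)\<^sup>2) has_field_derivative
        (\<Sum>i\<in>UNIV. b i * (2 * (g i z * deriv (g i) z)))) (at z)"
    proof (rule DERIV_sum)
      fix i
      show "((\<lambda>z. b i * (g i z)\<^sup>2) has_field_derivative b i * (2 * (g i z * deriv (g i) z))) (at z)"
        unfolding power2_eq_square
        by (rule DERIV_cong[OF DERIV_cmult[OF DERIV_mult[OF gd[OF z] gd[OF z]]]])
           (simp add: algebra_simps)
    qed
    have 2: "(\<Sum>i\<in>UNIV. b i * (g i z)\<^sup>2) = 0" if "z \<in> A" for z
      using zero[of "z *s w"] that by (simp add: A_def g_def)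
    have "(\<Sum>i\<in>UNIV. b i * (2 * (g i z * deriv (g i) z))) = 0"
      by (rule derivative_of_zero[OF A z 2 1])
    moreover have "(\<Sum>i\<in>UNIV. b i * (2 * (g i z * deriv (g i) z)))
        = 2 * (\<Sum>i\<in>UNIV. b i * (g i z * deriv (g i) z))"
      by (simp add: sum_distrib_left mult.left_commute)
    ultimately show ?thesis by simp
  qed
  show "(\<Sum>i\<in>UNIV. b i * (\<phi> 0 $ i * D 0 w $ i)) = 0"
    using first[OF A0] dg[OF A0] by (simp add: g_def)
  have 3: "((\<lambda>z. \<Sum>i\<in>UNIV. b i * (g i z * deriv (g i) z)) has_field_derivative
      (\<Sum>i\<in>UNIV. b i * ((deriv (g i) 0)\<^sup>2 + g i 0 * deriv (deriv (g i)) 0))) (at 0)"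
  proof (rule DERIV_sum)
    fix i
    show "((\<lambda>z. b i * (g i z * deriv (g i) z)) has_field_derivative
        b i * ((deriv (g i) 0)\<^sup>2 + g i 0 * deriv (deriv (g i)) 0)) (at 0)"
      unfolding power2_eq_square
      by (rule DERIV_cong[OF DERIV_cmult[OF DERIV_mult[OF gd[OF A0] g''[OF A0]]]])
         (simp add: algebra_simps)
  qed
  have "(\<Sum>i\<in>UNIV. b i * ((deriv (g i) 0)\<^sup>2 + g i 0 * deriv (deriv (g i)) 0)) = 0"
    by (rule derivative_of_zero[OF A A0 first 3])
  then show "(\<Sum>i\<in>UNIV. b i * ((D 0 w $ i)\<^sup>2 + \<phi> 0 $ i * ddir (ddir \<phi> w) w 0 $ i)) = 0"
    unfolding dd using dg[OF A0] by (simp add: g_def)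
qed

text \<open>
  The differential at 0 of the chosen parametrization at \<open>p\<close>, with the facts about it that determine
  the embedded tangent plane and the second fundamental form. In the last one, the coefficients
  \<open>S (a i) * p i\<close> are those of a tangent hyperplane.
\<close>

locale kummer_chart = kummer_general_point +
  fixes D :: "complex^2 \<Rightarrow> complex^6"
  assumes D_add: "D (u + v) = D u + D v" and D_scale: "D (d *s v) = d *s D v"
    and D_plane: "D w \<in> plane" and D_immersion: "D w \<in> vec.span {p} \<Longrightarrow> w = 0"
    and ddir_eq: "ddir (chart (kummer a) p) w 0 = D w"
    and chart_0: "chart (kummer a) p 0 = p"
    and II_eq: "degree S \<le> 2 \<Longrightarrow>
      (\<Sum>i\<in>UNIV. poly S (a i) * (p $ i * II (kummer a) p w w $ i)) = - net_quadric S (D w)"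

lemma (in kummer_general_point) kummer_chart_exists:
  obtains D where "kummer_chart a p e1 e2 c D"
proof -
  let ?\<phi> = "chart (kummer a) p"
  have "local_param (kummer a) p ?\<phi>"
    unfolding chart_def by (rule someI_ex[OF local_param_exists[OF p_in_X]])
  then obtain U where U: "open U" "0 \<in> U" "?\<phi> 0 = p" "?\<phi> ` U \<subseteq> kummer a"
    "\<And>s. s \<in> U \<Longrightarrow> \<exists>D. (?\<phi> has_derivative D) (at s) \<and> (\<forall>c v. D (c *s v) = c *s D v) \<and>
        (\<forall>v. D v \<in> vec.span {?\<phi> s} \<longrightarrow> v = 0)"
    by (rule local_paramE) (rule that)
  then obtain D where D: "\<And>s. s \<in> U \<Longrightarrow> (?\<phi> has_derivative D s) (at s)"
    "\<And>s c v. s \<in> U \<Longrightarrow> D s (c *s v) = c *s D s v"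
    "\<And>s v. s \<in> U \<Longrightarrow> D s v \<in> vec.span {?\<phi> s} \<Longrightarrow> v = 0"
    by metis
  have zero: "(\<Sum>i\<in>UNIV. a i ^ k * (?\<phi> s $ i)\<^sup>2) = 0" if "s \<in> U" "k < 3" for s k
    using U(4) that by (auto simp: kummer_iff moment_def)
  have first: "(\<Sum>i\<in>UNIV. a i ^ k * (?\<phi> 0 $ i * D 0 w $ i)) = 0" if "k < 3" for k w
    by (rule chart_second_order(2)[of U ?\<phi> D]) (use U(1,2) D(1,2) zero that in simp_all)
  have second: "(\<Sum>i\<in>UNIV. a i ^ k * ((D 0 w $ i)\<^sup>2 + ?\<phi> 0 $ i * ddir (ddir ?\<phi> w) w 0 $ i)) = 0"
    if "k < 3" for k w
    by (rule chart_second_order(3)[of U ?\<phi> D]) (use U(1,2) D(1,2) zero that in simp_all)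
  have "kummer_chart a p e1 e2 c (D 0)"
  proof
    have lin: "linear (D 0)" using D(1)[OF U(2)] has_derivative_linear by blast
    show "D 0 (u + v) = D 0 u + D 0 v" for u v by (rule linear_add[OF lin])
    show "D 0 (d *s v) = d *s D 0 v" for d v by (rule D(2)[OF U(2)])
    show "D 0 w \<in> plane" for w
      using first U(3) by (simp add: plane_def moment_def)
    show "w = 0" if "D 0 w \<in> vec.span {p}" for w using D(3)[OF U(2)] that U(3) by simp
    show "ddir ?\<phi> w 0 = D 0 w" for w
      by (rule chart_second_order(1)[of U ?\<phi> D]) (use U(1,2) D(1,2) in simp_all)
    show "?\<phi> 0 = p" by (rule U(3))
    show "(\<Sum>i\<in>UNIV. poly S (a i) * (p $ i * II (kummer a) p w w $ i)) = - net_quadric S (D 0 w)"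
      if S: "degree S \<le> 2" for S w
    proof -
      have "moment k (\<lambda>i. (D 0 w $ i)\<^sup>2 + p $ i * II (kummer a) p w w $ i) = 0" if "k < 3" for k
        using second[OF that] U(3) by (simp add: moment_def II_def)
      from sum_poly_moments[OF S this]
      have "net_quadric S (D 0 w) + (\<Sum>i\<in>UNIV. poly S (a i) * (p $ i * II (kummer a) p w w $ i)) = 0"
        by (simp add: net_quadric_def distrib_left sum.distrib)
      then show ?thesis by (simp add: add_eq_0_iff)
    qed
  qed
  then show ?thesis by (rule that)
qed

context kummer_chart
begin

lemma D_independent: "w \<noteq> 0 \<Longrightarrow> r1 (D w) \<noteq> 0 \<or> r2 (D w) \<noteq> 0"
  using kernel[OF D_plane] D_immersion by blast

text \<open>
  The directions \<open>w\<close> are mapped injectively, hence bijectively, to the coordinates \<open>(r1, r2)\<close>.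
\<close>

lemma D_onto: obtains w where "r1 (D w) = x" "r2 (D w) = y"
proof -
  define f :: "complex^2 \<Rightarrow> complex^2" where "f w = (\<chi> j. if j = 1 then r1 (D w) else r2 (D w))" for w
  have lin: "Vector_Spaces.linear (*s) (*s) f"
    by unfold_locales
       (auto simp: f_def vec_eq_iff D_add D_scale r1_add r2_add r1_scale r2_scale algebra_simps)
  have "inj f"
  proof (subst vec.linear_inj_iff_eq_0[OF lin], intro allI impI)
    fix w assume "f w = 0"
    then have "r1 (D w) = 0" "r2 (D w) = 0" by (auto simp: f_def vec_eq_iff forall_2)
    then show "w = 0" using D_independent by blast
  qed
  then have "surj f" by (rule vec.linear_injective_imp_surjective[OF lin _ refl])
  then obtain w where "f w = (\<chi> j. if j = 1 then x else y)" by (metis surjD)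
  then have "r1 (D w) = x" "r2 (D w) = y" by (auto simp: f_def vec_eq_iff forall_2)
  then show ?thesis by (rule that)
qed

lemma emb_tangent_eq: "emb_tangent (kummer a) p = plane"
proof -
  have eq: "emb_tangent (kummer a) p = vec.span (insert p (range D))"
    by (simp add: emb_tangent_def gauss_def ddir_eq chart_0)
  have "v \<in> vec.span (insert p (range D))" if v: "v \<in> plane" for v
  proof -
    obtain w where w: "r1 (D w) = r1 v" "r2 (D w) = r2 v" by (rule D_onto)
    then have "v - D w \<in> vec.span {p}"
      using v D_plane subspace_T by (intro kernel) (auto simp: r_minus vec.subspace_diff)
    then have "v - D w \<in> vec.span (insert p (range D))"
      using vec.span_mono[of "{p}" "insert p (range D)"] by auto
    moreover have "D w \<in> vec.span (insert p (range D))" by (intro vec.span_base) simp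
    ultimately have "(v - D w) + D w \<in> vec.span (insert p (range D))" by (rule vec.span_add)
    then show ?thesis by simp
  qed
  moreover have "vec.span (insert p (range D)) \<subseteq> plane"
    using D_plane p_in subspace_T by (intro vec.span_minimal) auto
  ultimately show ?thesis using eq by auto
qed

lemma tangent_lines_eq: "tangent_lines (kummer a) p = lines"
  by (simp add: tangent_lines_def lines_def emb_tangent_eq)

text \<open>
  A hyperplane contains \<open>plane\<close> if it annihilates the vectors \<open>weight i * (a i)^k / p i\<close> for \<open>k < 3\<close>; this says
  that \<open>h i * weight i / p i\<close> lies in the kernel of the three moments.
\<close>

lemma conormal_eq: "conormal (kummer a) p = {\<chi> i. p $ i * poly S (a i) | S. degree S \<le> 2}"
proof (intro equalityI subsetI)
  fix h assume h: "h \<in> conormal (kummer a) p"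
  define z where "z i = h $ i * weight i / p $ i" for i
  have z: "moment k z = 0" if "k < 3" for k
  proof -
    have "degree (monom (1::complex) k) \<le> 2" using that degree_monom_le[of "1::complex" k] by linarith
    then have "pairing h (tangent_vector (monom 1 k)) = 0"
      using h tangent_vector_in_plane by (simp add: conormal_def emb_tangent_eq)
    then show ?thesis
      by (simp add: pairing_def tangent_vector_def moment_def z_def poly_monom mult_ac)
  qed
  have "h $ i = p $ i * poly (interp z) (a i)" for i
    using interp_correct[OF z, of i] weight_nonzero[of i] p_nonzero[of i]
    by (simp add: z_def field_simps)
  then have "h = (\<chi> i. p $ i * poly (interp z) (a i))" by (simp add: vec_eq_iff)
  then show "h \<in> {\<chi> i. p $ i * poly S (a i) | S. degree S \<le> 2}"
    using degree_interp by blast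
next
  fix h assume "h \<in> {\<chi> i. p $ i * poly S (a i) | S. degree S \<le> 2}"
  then obtain S where S: "h = (\<chi> i. p $ i * poly S (a i))" "degree S \<le> 2" by blast
  have "pairing h t = 0" if "t \<in> plane" for t
  proof -
    have "pairing h t = (\<Sum>i\<in>UNIV. poly S (a i) * (p $ i * t $ i))"
      by (simp add: pairing_def S(1) mult_ac)
    also have "\<dots> = 0" using that by (intro sum_poly_moments S(2)) (simp add: plane_def)
    finally show ?thesis .
  qed
  then show "h \<in> conormal (kummer a) p" by (simp add: conormal_def emb_tangent_eq)
qed

definition diag_form :: "complex \<Rightarrow> complex \<Rightarrow> complex^2 \<Rightarrow> complex" where
  "diag_form \<alpha> \<beta> w = \<alpha> * (r1 (D w))\<^sup>2 + \<beta> * (r2 (D w))\<^sup>2"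

text \<open>
  The form of the hyperplane with coefficients \<open>p i * S (a i)\<close> is minus the restriction of
  \<open>net_quadric S\<close>, and \<open>S\<close> can take arbitrary values at \<open>e1\<close> and \<open>e2\<close>.
\<close>

lemma II_forms_eq: "II_forms (kummer a) p = {diag_form \<alpha> \<beta> | \<alpha> \<beta>. True}"
proof -
  obtain g1 g2 where g: "g1 \<noteq> 0" "g2 \<noteq> 0"
    "\<And>S v. degree S \<le> 2 \<Longrightarrow> v \<in> plane \<Longrightarrow>
       net_quadric S v = g1 * poly S e1 * (r1 v)\<^sup>2 + g2 * poly S e2 * (r2 v)\<^sup>2"
    by (rule net_quadric_on_plane) (rule that)
  have form: "(\<lambda>w. pairing (\<chi> i. p $ i * poly S (a i)) (II (kummer a) p w w))
      = diag_form (- g1 * poly S e1) (- g2 * poly S e2)" if "degree S \<le> 2" for S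
  proof
    fix w
    have "pairing (\<chi> i. p $ i * poly S (a i)) (II (kummer a) p w w)
        = (\<Sum>i\<in>UNIV. poly S (a i) * (p $ i * II (kummer a) p w w $ i))"
      by (simp add: pairing_def mult_ac)
    also have "\<dots> = diag_form (- g1 * poly S e1) (- g2 * poly S e2) w"
      unfolding II_eq[OF that] g(3)[OF that D_plane] by (simp add: diag_form_def)
    finally show "pairing (\<chi> i. p $ i * poly S (a i)) (II (kummer a) p w w)
        = diag_form (- g1 * poly S e1) (- g2 * poly S e2) w" .
  qed
  show ?thesis
  proof (intro equalityI subsetI)
    fix q assume "q \<in> II_forms (kummer a) p"
    then show "q \<in> {diag_form \<alpha> \<beta> | \<alpha> \<beta>. True}"
      unfolding II_forms_def conormal_eq using form by auto
  next
    fix q assume "q \<in> {diag_form \<alpha> \<beta> | \<alpha> \<beta>. True}"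
    then obtain \<alpha> \<beta> where q: "q = diag_form \<alpha> \<beta>" by blast
    obtain S where S: "degree S \<le> 1" "poly S e1 = - \<alpha> / g1" "poly S e2 = - \<beta> / g2"
      using e_neq by (rule linear_interpolation)
    have "q = (\<lambda>w. pairing (\<chi> i. p $ i * poly S (a i)) (II (kummer a) p w w))"
      using S g(1,2) by (subst form) (simp_all add: q)
    moreover have "(\<chi> i. p $ i * poly S (a i)) \<in> conormal (kummer a) p"
      unfolding conormal_eq using S(1) by force
    ultimately show "q \<in> II_forms (kummer a) p"
      unfolding II_forms_def by (rule image_eqI)
  qed
qed

lemma diag_form_eq_0_iff: "diag_form \<alpha> \<beta> = (\<lambda>w. 0) \<longleftrightarrow> \<alpha> = 0 \<and> \<beta> = 0"
proof
  assume *: "diag_form \<alpha> \<beta> = (\<lambda>w. 0)"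
  obtain u where "r1 (D u) = 1" "r2 (D u) = 0" by (rule D_onto)
  moreover obtain v where "r1 (D v) = 0" "r2 (D v) = 1" by (rule D_onto)
  ultimately show "\<alpha> = 0 \<and> \<beta> = 0"
    using fun_cong[OF *, of u] fun_cong[OF *, of v] by (simp add: diag_form_def)
qed (simp add: diag_form_def fun_eq_iff)

lemma dim_II_eq: "dim_II (kummer a) p = 1"
proof -
  have comb: "diag_form \<alpha> \<beta> = (\<lambda>w. \<alpha> * diag_form 1 0 w) + (\<lambda>w. \<beta> * diag_form 0 1 w)" for \<alpha> \<beta>
    by (simp add: fun_eq_iff diag_form_def)
  have "II_forms (kummer a) p = cfun.span {diag_form 1 0, diag_form 0 1}"
  proof (intro equalityI subsetI)
    fix q assume "q \<in> II_forms (kummer a) p"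
    then obtain \<alpha> \<beta> where "q = diag_form \<alpha> \<beta>" by (auto simp: II_forms_eq)
    then show "q \<in> cfun.span {diag_form 1 0, diag_form 0 1}"
      using comb[of \<alpha> \<beta>] cfun.span_base[of _ "{diag_form 1 0, diag_form 0 1}"]
      by (simp only:) (intro cfun.span_add cfun.span_scale; simp)
  next
    fix q assume "q \<in> cfun.span {diag_form 1 0, diag_form 0 1}"
    then obtain \<alpha> where "q - (\<lambda>w. \<alpha> * diag_form 1 0 w) \<in> cfun.span {diag_form 0 1}"
      by (auto simp: cfun.span_breakdown_eq)
    then obtain \<beta> where "q - (\<lambda>w. \<alpha> * diag_form 1 0 w) = (\<lambda>w. \<beta> * diag_form 0 1 w)"
      by (auto simp: cfun.span_singleton)
    then have "q = diag_form \<alpha> \<beta>"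
      unfolding comb[of \<alpha> \<beta>] by (simp add: diff_eq_eq add.commute)
    then show "q \<in> II_forms (kummer a) p" by (auto simp: II_forms_eq)
  qed
  moreover have ne: "diag_form 1 0 \<notin> cfun.span {diag_form 0 1}"
  proof
    assume "diag_form 1 0 \<in> cfun.span {diag_form 0 1}"
    then obtain \<beta> where "diag_form 1 0 = (\<lambda>w. \<beta> * diag_form 0 1 w)" by (auto simp: cfun.span_singleton)
    then have "diag_form 1 (- \<beta>) = (\<lambda>w. 0)" by (simp add: fun_eq_iff diag_form_def)
    then show False by (simp add: diag_form_eq_0_iff)
  qed
  moreover have "cfun.independent {diag_form 0 1}"
    using diag_form_eq_0_iff[of 0 1] by (simp only: cfun.dependent_single zero_fun_def) simp
  then have "cfun.independent {diag_form 1 0, diag_form 0 1}"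
    by (rule cfun.independent_insertI[OF ne])
  moreover have "diag_form 1 0 \<noteq> diag_form 0 1" using ne cfun.span_base[of "diag_form 0 1" "{diag_form 0 1}"] by auto
  ultimately show ?thesis
    by (simp add: dim_II_def cfun.dim_eq_card_independent)
qed

lemma base_point_free: "II_base_point_free (kummer a) p"
  unfolding II_base_point_free_def
proof (intro allI impI)
  fix w :: "complex^2" assume "w \<noteq> 0"
  then have "diag_form 1 0 w \<noteq> 0 \<or> diag_form 0 1 w \<noteq> 0" using D_independent by (simp add: diag_form_def)
  then show "\<exists>q\<in>II_forms (kummer a) p. q w \<noteq> 0" unfolding II_forms_eq by blast
qed

lemma zeros_of_diag_form:
  assumes "\<alpha> \<noteq> 0 \<or> \<beta> \<noteq> 0"
  shows "{tangent_line (kummer a) p w | w. w \<noteq> 0 \<and> diag_form \<alpha> \<beta> w = 0} = cut \<alpha> \<beta>"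
proof (intro equalityI subsetI)
  fix L assume "L \<in> {tangent_line (kummer a) p w | w. w \<noteq> 0 \<and> diag_form \<alpha> \<beta> w = 0}"
  then obtain w where w: "L = tangent_line (kummer a) p w" "w \<noteq> 0" "diag_form \<alpha> \<beta> w = 0" by blast
  show "L \<in> cut \<alpha> \<beta>"
    unfolding w(1) tangent_line_def ddir_eq span2_in_cut_iff[OF D_plane D_independent[OF w(2)]]
    using w(3) by (simp add: diag_form_def)
next
  fix L assume L: "L \<in> cut \<alpha> \<beta>"
  then have "L \<in> lines" by (simp add: cut_def)
  then obtain v where v: "v \<in> plane" "r1 v \<noteq> 0 \<or> r2 v \<noteq> 0" "L = vec.span {p, v}"
    by (rule lineE)
  obtain w where w: "r1 (D w) = r1 v" "r2 (D w) = r2 v" by (rule D_onto)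
  have "vec.span {p, D w} = vec.span {p, v}"
    using v w by (intro span2_eqI D_plane) auto
  then have "L = tangent_line (kummer a) p w" by (simp add: tangent_line_def ddir_eq v(3))
  moreover have "w \<noteq> 0" using v(2) w D_scale[of 0 0] r1_scale[of 0] r2_scale[of 0] by auto
  moreover have "diag_form \<alpha> \<beta> w = 0"
    using L span2_in_cut_iff[OF v(1,2)] by (simp add: v(3) diag_form_def w)
  ultimately show "L \<in> {tangent_line (kummer a) p w | w. w \<noteq> 0 \<and> diag_form \<alpha> \<beta> w = 0}" by blast
qed

lemma II_pairs_eq: "II_pairs (kummer a) p = pairs"
proof -
  have "II_pairs (kummer a) p = {{tangent_line (kummer a) p w | w. w \<noteq> 0 \<and> diag_form \<alpha> \<beta> w = 0} | \<alpha> \<beta>.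
      \<alpha> \<noteq> 0 \<or> \<beta> \<noteq> 0}"
    unfolding II_pairs_def II_forms_eq using diag_form_eq_0_iff by blast
  also have "\<dots> = {cut \<alpha> \<beta> | \<alpha> \<beta>. \<alpha> \<noteq> 0 \<or> \<beta> \<noteq> 0}"
    using zeros_of_diag_form by (intro Collect_cong ex_cong1) auto
  finally show ?thesis by (simp add: pairs_def)
qed

end

section \<open>The involution of the net and the general point\<close>

context kummer_chart
begin

text \<open>
  A quadric of the net contains the plane if and only if its two diagonal coefficients vanish.
\<close>

lemma net_values:
  obtains g1 g2 where "g1 \<noteq> 0" "g2 \<noteq> 0"
    "\<And>S. degree S \<le> 2 \<Longrightarrow>
       contains_tangent_plane (net_quadric S) (kummer a) p \<longleftrightarrow> poly S e1 = 0 \<and> poly S e2 = 0"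
    "\<And>S v. degree S \<le> 2 \<Longrightarrow> v \<in> plane \<Longrightarrow>
       net_quadric S v = g1 * poly S e1 * (r1 v)\<^sup>2 + g2 * poly S e2 * (r2 v)\<^sup>2"
proof -
  obtain g1 g2 where g: "g1 \<noteq> 0" "g2 \<noteq> 0"
    "\<And>S v. degree S \<le> 2 \<Longrightarrow> v \<in> plane \<Longrightarrow>
       net_quadric S v = g1 * poly S e1 * (r1 v)\<^sup>2 + g2 * poly S e2 * (r2 v)\<^sup>2"
    by (rule net_quadric_on_plane) (rule that)
  have "contains_tangent_plane (net_quadric S) (kummer a) p \<longleftrightarrow> poly S e1 = 0 \<and> poly S e2 = 0"
    if S: "degree S \<le> 2" for S
  proof
    assume "contains_tangent_plane (net_quadric S) (kummer a) p"
    then have "net_quadric S v1 = 0" "net_quadric S v2 = 0"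
      using v_in by (simp_all add: contains_tangent_plane_def emb_tangent_eq)
    then show "poly S e1 = 0 \<and> poly S e2 = 0"
      using g(1,2) by (simp add: g(3)[OF S] v_in r_v)
  next
    assume "poly S e1 = 0 \<and> poly S e2 = 0"
    then show "contains_tangent_plane (net_quadric S) (kummer a) p"
      by (simp add: contains_tangent_plane_def emb_tangent_eq g(3)[OF S])
  qed
  then show thesis using g by (intro that[of g1 g2])
qed

lemma net_cut:
  assumes "\<And>v. v \<in> plane \<Longrightarrow> Q v = \<alpha> * (r1 v)\<^sup>2 + \<beta> * (r2 v)\<^sup>2"
  shows "lines_cut Q (kummer a) p = cut \<alpha> \<beta>"
proof -
  have "L \<subseteq> plane" if "L \<in> lines" for L using that by (simp add: lines_def)
  then show ?thesis
    using assms by (fastforce simp: lines_cut_def cut_def tangent_lines_eq)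
qed

lemma net_pairs_eq: "net_pairs (kummer_net a) (kummer a) p = pairs"
proof -
  obtain g1 g2 where g: "g1 \<noteq> 0" "g2 \<noteq> 0"
    "\<And>S. degree S \<le> 2 \<Longrightarrow>
       contains_tangent_plane (net_quadric S) (kummer a) p \<longleftrightarrow> poly S e1 = 0 \<and> poly S e2 = 0"
    "\<And>S v. degree S \<le> 2 \<Longrightarrow> v \<in> plane \<Longrightarrow>
       net_quadric S v = g1 * poly S e1 * (r1 v)\<^sup>2 + g2 * poly S e2 * (r2 v)\<^sup>2"
    by (rule net_values) (rule that)
  have cut: "lines_cut (net_quadric S) (kummer a) p = cut (g1 * poly S e1) (g2 * poly S e2)"
    if "degree S \<le> 2" for S
    using g(4)[OF that] by (rule net_cut)
  show ?thesis
  proof (intro equalityI subsetI)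
    fix P assume "P \<in> net_pairs (kummer_net a) (kummer a) p"
    then obtain Q where Q: "P = lines_cut Q (kummer a) p" "Q \<in> kummer_net a"
      "\<not> contains_tangent_plane Q (kummer a) p" unfolding net_pairs_def by blast
    then obtain S where S: "Q = net_quadric S" "degree S \<le> 2" unfolding kummer_net_eq by blast
    have "g1 * poly S e1 \<noteq> 0 \<or> g2 * poly S e2 \<noteq> 0"
      using Q(3) g(1,2) unfolding S(1) g(3)[OF S(2)] by simp
    then show "P \<in> pairs" unfolding Q(1) S(1) cut[OF S(2)] pairs_def by blast
  next
    fix P assume "P \<in> pairs"
    then obtain \<alpha> \<beta> where P: "P = cut \<alpha> \<beta>" "\<alpha> \<noteq> 0 \<or> \<beta> \<noteq> 0" unfolding pairs_def by blast
    obtain S where S: "degree S \<le> 1" "poly S e1 = \<alpha> / g1" "poly S e2 = \<beta> / g2"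
      using e_neq by (rule linear_interpolation)
    have deg: "degree S \<le> 2" using S(1) by simp
    have "P = lines_cut (net_quadric S) (kummer a) p"
      using g(1,2) by (simp add: cut[OF deg] P(1) S)
    moreover have "\<not> contains_tangent_plane (net_quadric S) (kummer a) p"
      unfolding g(3)[OF deg] using P(2) S g(1,2) by auto
    moreover have "net_quadric S \<in> kummer_net a" unfolding kummer_net_eq using deg by blast
    ultimately show "P \<in> net_pairs (kummer_net a) (kummer a) p"
      unfolding net_pairs_def by blast
  qed
qed

lemma net_cut_covers:
  assumes "Q \<in> kummer_net a" "\<not> contains_tangent_plane Q (kummer a) p"
  shows "{t \<in> emb_tangent (kummer a) p. Q t = 0} = \<Union> (lines_cut Q (kummer a) p)"
proof -
  obtain g1 g2 where g: "g1 \<noteq> 0" "g2 \<noteq> 0"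
    "\<And>S. degree S \<le> 2 \<Longrightarrow>
       contains_tangent_plane (net_quadric S) (kummer a) p \<longleftrightarrow> poly S e1 = 0 \<and> poly S e2 = 0"
    "\<And>S v. degree S \<le> 2 \<Longrightarrow> v \<in> plane \<Longrightarrow>
       net_quadric S v = g1 * poly S e1 * (r1 v)\<^sup>2 + g2 * poly S e2 * (r2 v)\<^sup>2"
    by (rule net_values) (rule that)
  obtain S where S: "Q = net_quadric S" "degree S \<le> 2" using assms(1) unfolding kummer_net_eq by blast
  have "g1 * poly S e1 \<noteq> 0 \<or> g2 * poly S e2 \<noteq> 0"
    using assms(2) g(1,2) unfolding S(1) g(3)[OF S(2)] by simp
  then have "{t \<in> plane. g1 * poly S e1 * (r1 t)\<^sup>2 + g2 * poly S e2 * (r2 t)\<^sup>2 = 0}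
      = \<Union> (cut (g1 * poly S e1) (g2 * poly S e2))"
    by (rule cut_covers)
  moreover have "lines_cut Q (kummer a) p = cut (g1 * poly S e1) (g2 * poly S e2)"
    using g(4)[OF S(2)] unfolding S(1) by (rule net_cut)
  moreover have "{t \<in> plane. Q t = 0} = {t \<in> plane. g1 * poly S e1 * (r1 t)\<^sup>2 + g2 * poly S e2 * (r2 t)\<^sup>2 = 0}"
    using g(4)[OF S(2)] unfolding S(1) by auto
  ultimately show ?thesis by (simp add: emb_tangent_eq)
qed

text \<open>
  The polynomials \<open>S\<close> vanishing at both roots are the multiples of one quadratic polynomial.
\<close>

lemma one_quadric_contains_plane:
  "cfun.dim {Q \<in> kummer_net a. contains_tangent_plane Q (kummer a) p} = 1"
proof -
  define P where "P = [:- e1, 1:] * [:- e2, 1:]"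
  have P: "degree P \<le> 2" by (simp add: P_def)
  have scale: "net_quadric (smult d S) = (\<lambda>x. d * net_quadric S x)" for d S
    by (simp add: net_quadric_def fun_eq_iff sum_distrib_left mult.assoc)
  obtain g1 g2 where contains: "\<And>S. degree S \<le> 2 \<Longrightarrow>
       contains_tangent_plane (net_quadric S) (kummer a) p \<longleftrightarrow> poly S e1 = 0 \<and> poly S e2 = 0"
    by (rule net_values) (rule that)
  have "{Q \<in> kummer_net a. contains_tangent_plane Q (kummer a) p} = cfun.span {net_quadric P}"
  proof (intro equalityI subsetI)
    fix Q assume "Q \<in> {Q \<in> kummer_net a. contains_tangent_plane Q (kummer a) p}"
    then obtain S where S: "Q = net_quadric S" "degree S \<le> 2" "contains_tangent_plane Q (kummer a) p"
      unfolding kummer_net_eq by blast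
    then have "S = smult (coeff S 2) P"
      unfolding P_def using e_neq contains[OF S(2)] by (intro quadratic_of_roots) auto
    then have "Q = (\<lambda>x. coeff S 2 * net_quadric P x)" using S(1) scale by metis
    then show "Q \<in> cfun.span {net_quadric P}" unfolding cfun.span_singleton by blast
  next
    fix Q assume "Q \<in> cfun.span {net_quadric P}"
    then obtain d where "Q = (\<lambda>x. d * net_quadric P x)"
      unfolding cfun.span_singleton by blast
    then have "Q = net_quadric (smult d P)" by (simp only: scale)
    moreover have "degree (smult d P) \<le> 2" using P degree_smult_le[of d P] by linarith
    moreover have "contains_tangent_plane (net_quadric (smult d P)) (kummer a) p"
      unfolding contains[OF \<open>degree (smult d P) \<le> 2\<close>] by (simp add: P_def algebra_simps)
    ultimately show "Q \<in> {Q \<in> kummer_net a. contains_tangent_plane Q (kummer a) p}"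
      unfolding kummer_net_eq by blast
  qed
  moreover have "net_quadric P \<noteq> (\<lambda>x. 0)"
  proof
    assume *: "net_quadric P = (\<lambda>x. 0)"
    have "net_quadric P (axis 0 1) = (\<Sum>i\<in>UNIV. if i = 0 then poly P (a i) else 0)"
      unfolding net_quadric_def by (intro sum.cong) (auto simp: axis_def)
    then have "poly P (a 0) = 0" using fun_cong[OF *, of "axis 0 1"] by simp
    moreover have "poly P (a 0) = (a 0 - e1) * (a 0 - e2)" by (simp add: P_def algebra_simps)
    ultimately show False using e_not_node by auto
  qed
  then have "cfun.independent {net_quadric P}" by (simp only: cfun.dependent_single zero_fun_def) simp
  ultimately show ?thesis by (simp add: cfun.dim_eq_card_independent)
qed

end

context six_points
begin

lemma form_coeff_interp: "j \<le> 2 \<Longrightarrow> form 2 (\<lambda>x. coeff (interp (\<lambda>i. (x $ i)\<^sup>2)) j)"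
proof -
  assume "j \<le> 2"
  then have "j = 0 \<or> j = 1 \<or> j = 2" by linarith
  then show ?thesis
    unfolding interp_def Let_def
    using form_quadric[of 3] form_quadric[of 4] form_quadric[of 5]
    by (elim disjE)
       (auto simp: quadric_eq_moment[abs_def] numeral_2_eq_2 intro!: form_diff form_scale)
qed

definition discriminant :: "complex^6 \<Rightarrow> complex" where
  "discriminant x = (let R = interp (\<lambda>i. (x $ i)\<^sup>2) in (coeff R 1)\<^sup>2 - 4 * (coeff R 0 * coeff R 2))"

text \<open>
  Nonzero at points all of whose coordinates are nonzero and whose polynomial is of degree 2 with
  distinct roots.
\<close>

definition degeneracy :: "complex^6 \<Rightarrow> complex" where
  "degeneracy x = (\<Prod>i\<in>UNIV. x $ i) * (coeff (interp (\<lambda>i. (x $ i)\<^sup>2)) 2 * discriminant x)"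

lemma form_degeneracy: "form 12 degeneracy"
proof -
  have "form (2 * 2) (\<lambda>x. (coeff (interp (\<lambda>i. (x $ i)\<^sup>2)) 1)\<^sup>2)"
    by (intro form_power form_coeff_interp) simp
  moreover have "form (2 + 2) (\<lambda>x. coeff (interp (\<lambda>i. (x $ i)\<^sup>2)) 0 * coeff (interp (\<lambda>i. (x $ i)\<^sup>2)) 2)"
    by (intro form_mult form_coeff_interp) simp_all
  ultimately have "form 4 discriminant"
    unfolding discriminant_def[abs_def] Let_def by (intro form_diff form_scale) simp_all
  then have "form (CARD(6) + (2 + 4)) degeneracy"
    unfolding degeneracy_def[abs_def] by (intro form_mult form_prod_coordinates form_coeff_interp) simp_all
  then show ?thesis by simp
qed

lemma general_point_if_nondegenerate:
  assumes p: "p \<in> kummer a" "degeneracy p \<noteq> 0"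
  obtains e1 e2 c where "kummer_general_point a p e1 e2 c"
proof -
  define R where "R = interp (\<lambda>i. (p $ i)\<^sup>2)"
  define d where "d = csqrt (discriminant p)"
  define e1 where "e1 = (- coeff R 1 + d) / (2 * coeff R 2)"
  define e2 where "e2 = (- coeff R 1 - d) / (2 * coeff R 2)"
  have nz: "p $ i \<noteq> 0" for i using p(2) by (auto simp: degeneracy_def)
  have c: "coeff R 2 \<noteq> 0" and disc: "discriminant p \<noteq> 0" using p(2) by (auto simp: degeneracy_def R_def)
  have d: "d\<^sup>2 = (coeff R 1)\<^sup>2 - 4 * (coeff R 0 * coeff R 2)" "d \<noteq> 0"
    using disc by (auto simp: d_def discriminant_def R_def Let_def)
  have "e1 - e2 = d / coeff R 2" unfolding e1_def e2_def using c by (simp add: field_simps)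
  then have neq: "e1 \<noteq> e2" using c d(2) by auto
  have sum: "coeff R 2 * (e1 + e2) = - coeff R 1"
    unfolding e1_def e2_def using c by (simp add: field_simps)
  have "coeff R 2 * (e1 * e2) = ((coeff R 1)\<^sup>2 - d\<^sup>2) / (4 * coeff R 2)"
    unfolding e1_def e2_def using c by (simp add: field_simps power2_eq_square)
  also have "\<dots> = coeff R 0" unfolding d(1) using c by (simp add: field_simps)
  finally have prod: "coeff R 2 * (e1 * e2) = coeff R 0" .
  have c1: "coeff R 1 = - (coeff R 2 * (e1 + e2))" unfolding sum by simp
  have "R = [:coeff R 0, coeff R 1, coeff R 2:]"
    by (rule degree_le_2_eq) (simp add: R_def degree_interp)
  also have "\<dots> = smult (coeff R 2) ([:- e1, 1:] * [:- e2, 1:])"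
    unfolding c1 prod[symmetric] by (simp add: algebra_simps)
  finally have "interp (\<lambda>i. (p $ i)\<^sup>2) = smult (coeff R 2) ([:- e1, 1:] * [:- e2, 1:])"
    by (simp only: R_def)
  then have "kummer_general_point a p e1 e2 (coeff R 2)"
    using p(1) nz neq c by unfold_locales
  then show ?thesis by (rule that)
qed

text \<open>
  The degeneracy form does not vanish at a point with \<open>P = (t - b\<^sub>1) (t - b\<^sub>2)\<close> if \<open>b\<^sub>1\<close> and \<open>b\<^sub>2\<close> are
  distinct and are not among the \<open>a i\<close>.
\<close>

lemma general_pointI:
  assumes "\<And>p e1 e2 c. kummer_general_point a p e1 e2 c \<Longrightarrow> Pr p"
  shows "general_point (kummer a) Pr"
  unfolding general_point_def
proof (intro exI[of _ "{x. x \<noteq> 0 \<and> degeneracy x = 0}"] conjI ballI)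
  show "zariski_closed {x. x \<noteq> 0 \<and> degeneracy x = 0}"
    unfolding zariski_closed_def using form_degeneracy by (intro exI[of _ "{degeneracy}"]) auto
  show "Pr x" if "x \<in> kummer a - {x. x \<noteq> 0 \<and> degeneracy x = 0}" for x
  proof -
    have "x \<in> kummer a" "degeneracy x \<noteq> 0" using that by (auto simp: kummer_iff)
    then show ?thesis using assms by (rule general_point_if_nondegenerate)
  qed
  obtain b1 where b1: "b1 \<notin> range a"
    using ex_new_if_finite[OF infinite_UNIV_char_0, of "range a"] by auto
  obtain b2 where b2: "b2 \<notin> range a" "b2 \<noteq> b1"
    using ex_new_if_finite[OF infinite_UNIV_char_0, of "insert b1 (range a)"] by auto
  define R where "R = [:- b1, 1:] * [:- b2, 1:]"
  have R: "degree R \<le> 2" "R \<noteq> 0" by (simp_all add: R_def)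
  define x :: "complex^6" where "x = (\<chi> i. csqrt (weight i * poly R (a i)))"
  have "x \<in> kummer a" unfolding x_def by (rule kummer_point[OF R])
  moreover have "degeneracy x \<noteq> 0"
  proof -
    have "interp (\<lambda>i. (x $ i)\<^sup>2) = R" by (simp add: x_def interp_poly[OF R(1)])
    moreover have "coeff R 2 = 1" "(coeff R 1)\<^sup>2 - 4 * (coeff R 0 * coeff R 2) = (b1 - b2)\<^sup>2"
      by (simp_all add: R_def numeral_2_eq_2) (simp add: power2_eq_square algebra_simps)
    moreover have "x $ i \<noteq> 0" for i
    proof -
      have "poly R (a i) = (a i - b1) * (a i - b2)" by (simp add: R_def algebra_simps)
      then show ?thesis using b1 b2(1) weight_nonzero[of i] by (auto simp: x_def)
    qed
    ultimately show ?thesis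
      using b2(2) by (simp add: degeneracy_def discriminant_def Let_def)
  qed
  ultimately show "\<not> kummer a \<subseteq> {x. x \<noteq> 0 \<and> degeneracy x = 0}" by auto
qed

end

theorem theorem3p2:
  fixes a :: "6 \<Rightarrow> complex"
  assumes "inj a"
  shows "(\<forall>p\<in>kummer a. smooth_point (kummer a) p) \<and>
    Phi_surface (kummer a) \<and>
    not_covered_by_lines (kummer a) \<and>
    general_point (kummer a) (\<lambda>p.
      smooth_point (kummer a) p \<and>
      dim_II (kummer a) p = 1 \<and> II_base_point_free (kummer a) p \<and>
      involution_with_pairs (tangent_lines (kummer a) p)
        (tau_II (kummer a) p) (II_pairs (kummer a) p) \<and>
      cfun.dim {Q \<in> kummer_net a. contains_tangent_plane Q (kummer a) p} = 1 \<and>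
      (\<forall>Q\<in>kummer_net a. \<not> contains_tangent_plane Q (kummer a) p \<longrightarrow>
         {t \<in> emb_tangent (kummer a) p. Q t = 0} = \<Union>(lines_cut Q (kummer a) p)) \<and>
      involution_with_pairs (tangent_lines (kummer a) p)
        (sigma_net (kummer_net a) (kummer a) p) (net_pairs (kummer_net a) (kummer a) p) \<and>
      (\<forall>L\<in>tangent_lines (kummer a) p. sigma_net (kummer_net a) (kummer a) p L = tau_II (kummer a) p L))"
proof -
  interpret six_points a by unfold_locales (rule assms)
  have smooth: "smooth_point (kummer a) p" if "p \<in> kummer a" for p
    using that local_param_exists by (simp add: smooth_point_def)
  have surface: "projective_surface (kummer a)"
    using projective_variety_kummer smooth
    by (auto simp: projective_surface_def projective_variety_def)
  have Phi: "Phi_surface (kummer a)"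
    unfolding Phi_surface_def
  proof (intro conjI surface general_pointI)
    fix p e1 e2 c assume gp: "kummer_general_point a p e1 e2 c"
    then obtain D where "kummer_chart a p e1 e2 c D"
      by (rule kummer_general_point.kummer_chart_exists)
    then show "dim_II (kummer a) p = 1" by (rule kummer_chart.dim_II_eq)
    show "smooth_point (kummer a) p" using gp by (intro smooth kummer_general_point.p_in_X)
  qed simp
  have lines: "not_covered_by_lines (kummer a)"
    unfolding not_covered_by_lines_def
  proof (rule general_pointI)
    fix p e1 e2 c assume gp: "kummer_general_point a p e1 e2 c"
    show "\<not> (\<exists>L. vec.subspace L \<and> vec.dim L = 2 \<and> p \<in> L \<and> L - {0} \<subseteq> kummer a)"
      using kummer_general_point.no_line_through_p[OF gp] by blast
  qed
  show ?thesis
  proof (intro conjI)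
    show "\<forall>p\<in>kummer a. smooth_point (kummer a) p" using smooth by blast
    show "Phi_surface (kummer a)" by (rule Phi)
    show "not_covered_by_lines (kummer a)" by (rule lines)
  next
    show "general_point (kummer a) (\<lambda>p.
        smooth_point (kummer a) p \<and>
        dim_II (kummer a) p = 1 \<and> II_base_point_free (kummer a) p \<and>
        involution_with_pairs (tangent_lines (kummer a) p)
          (tau_II (kummer a) p) (II_pairs (kummer a) p) \<and>
        cfun.dim {Q \<in> kummer_net a. contains_tangent_plane Q (kummer a) p} = 1 \<and>
        (\<forall>Q\<in>kummer_net a. \<not> contains_tangent_plane Q (kummer a) p \<longrightarrow>
           {t \<in> emb_tangent (kummer a) p. Q t = 0} = \<Union>(lines_cut Q (kummer a) p)) \<and>
        involution_with_pairs (tangent_lines (kummer a) p)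
          (sigma_net (kummer_net a) (kummer a) p) (net_pairs (kummer_net a) (kummer a) p) \<and>
        (\<forall>L\<in>tangent_lines (kummer a) p. sigma_net (kummer_net a) (kummer a) p L = tau_II (kummer a) p L))"
    proof (rule general_pointI, intro conjI)
      fix p e1 e2 c assume gp: "kummer_general_point a p e1 e2 c"
      then obtain D where "kummer_chart a p e1 e2 c D"
        by (rule kummer_general_point.kummer_chart_exists)
      then interpret kummer_chart a p e1 e2 c D .
      show "smooth_point (kummer a) p" by (intro smooth p_in_X)
      show "dim_II (kummer a) p = 1" by (rule dim_II_eq)
      show "II_base_point_free (kummer a) p" by (rule base_point_free)
      show "involution_with_pairs (tangent_lines (kummer a) p)
          (tau_II (kummer a) p) (II_pairs (kummer a) p)"
        unfolding tau_II_def tangent_lines_eq II_pairs_eq by (rule involution_pairs)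
      show "cfun.dim {Q \<in> kummer_net a. contains_tangent_plane Q (kummer a) p} = 1"
        by (rule one_quadric_contains_plane)
      show "\<forall>Q\<in>kummer_net a. \<not> contains_tangent_plane Q (kummer a) p \<longrightarrow>
           {t \<in> emb_tangent (kummer a) p. Q t = 0} = \<Union>(lines_cut Q (kummer a) p)"
        using net_cut_covers by blast
      show "involution_with_pairs (tangent_lines (kummer a) p)
          (sigma_net (kummer_net a) (kummer a) p) (net_pairs (kummer_net a) (kummer a) p)"
        unfolding sigma_net_def tangent_lines_eq net_pairs_eq by (rule involution_pairs)
      show "\<forall>L\<in>tangent_lines (kummer a) p.
          sigma_net (kummer_net a) (kummer a) p L = tau_II (kummer a) p L"
        by (simp add: sigma_net_def tau_II_def net_pairs_eq II_pairs_eq)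
    qed
  qed
qed

end
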